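(* Let $G$ be a finite group which is not nilpotent, let $S$ be a finite set, and let $\alpha$ be a faithful (left) action of $G$ on $S$, written $(g,s)\mapsto gs$. Let $\mathbb{A}(G,S,\alpha)^\ast$ be the algebra with universe $G\times S$ and two basic operations: a unary operation $f$ given by $f((g,s))=(g,gs)$ and a binary operation $d$ given by $d((g_1,s_1),(g_2,s_2))=(g_1,s_2)$. Then $\mathbb{A}(G,S,\alpha)^\ast$ is inherently nonfinitely based in the finite sense: for every $n\geq 1$ there exists $d\geq 1$ such that $\mathscr{V}(\mathbb{A}(G,S,\alpha)^\ast)^{(n)}$ contains arbitrarily large finite $d$-generated algebras.
   Context: For a finite algebra $\mathbf{A}$ (with finitely many basic operations) and $n\geq 1$, $\mathscr{V}(\mathbf{A})^{(n)}$ denotes the class of all algebras (in the same signature) satisfying every identity in at most $n$ variables that is valid in $\mathbf{A}$. "Arbitrarily large finite $d$-generated algebras" means: for every $\ell>0$ there is a finite algebra in the class, generated by at most $d$ elements, with at least $\ell$ elements. *)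

theory Defs
  imports "HOL-Algebra.Group_Action" "HOL-Algebra.Generated_Groups"
begin

primrec lower_central :: "('g, 'm) monoid_scheme \<Rightarrow> nat \<Rightarrow> 'g set" where
  "lower_central G 0 = carrier G"
| "lower_central G (Suc n) =
     generate G (\<Union>x \<in> lower_central G n. \<Union>y \<in> carrier G.
       {x \<otimes>\<^bsub>G\<^esub> y \<otimes>\<^bsub>G\<^esub> (inv\<^bsub>G\<^esub> x) \<otimes>\<^bsub>G\<^esub> (inv\<^bsub>G\<^esub> y)})"

definition nilpotent_group :: "('g, 'm) monoid_scheme \<Rightarrow> bool" where
  "nilpotent_group G \<longleftrightarrow> group G \<and> (\<exists>n. lower_central G n = {\<one>\<^bsub>G\<^esub>})"

text \<open>A signature is a type \<open>'f\<close> of operation symbols with an arity function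
  \<open>ar :: 'f \<Rightarrow> nat\<close>. The basic operations take argument lists; only the values on lists
  over the universe of the prescribed length are relevant.\<close>

record ('f, 'a) ualg =
  universe :: "'a set"
  oper :: "'f \<Rightarrow> 'a list \<Rightarrow> 'a"

definition is_algebra :: "('f \<Rightarrow> nat) \<Rightarrow> ('f, 'a) ualg \<Rightarrow> bool" where
  "is_algebra ar A \<longleftrightarrow>
     universe A \<noteq> {} \<and>
     (\<forall>f xs. length xs = ar f \<longrightarrow> set xs \<subseteq> universe A \<longrightarrow> oper A f xs \<in> universe A)"

datatype 'f trm = Var nat | App 'f "'f trm list"

primrec trm_vars :: "'f trm \<Rightarrow> nat set" where
  "trm_vars (Var x) = {x}"
| "trm_vars (App f ts) = (\<Union>(set (map trm_vars ts)))"

primrec wf_trm :: "('f \<Rightarrow> nat) \<Rightarrow> 'f trm \<Rightarrow> bool" where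
  "wf_trm ar (Var x) \<longleftrightarrow> True"
| "wf_trm ar (App f ts) \<longleftrightarrow> length ts = ar f \<and> list_all id (map (wf_trm ar) ts)"

primrec eval_trm :: "('f, 'a) ualg \<Rightarrow> (nat \<Rightarrow> 'a) \<Rightarrow> 'f trm \<Rightarrow> 'a" where
  "eval_trm A e (Var x) = e x"
| "eval_trm A e (App f ts) = oper A f (map (eval_trm A e) ts)"

definition satisfies :: "('f, 'a) ualg \<Rightarrow> 'f trm \<times> 'f trm \<Rightarrow> bool" where
  "satisfies A p \<longleftrightarrow>
     (\<forall>e. range e \<subseteq> universe A \<longrightarrow> eval_trm A e (fst p) = eval_trm A e (snd p))"

definition identities_upto :: "('f \<Rightarrow> nat) \<Rightarrow> nat \<Rightarrow> ('f trm \<times> 'f trm) set" where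
  "identities_upto ar n =
     {(s, t). wf_trm ar s \<and> wf_trm ar t \<and> card (trm_vars s \<union> trm_vars t) \<le> n}"

text \<open>The algebras over the carrier type \<open>'b\<close> in the class \<open>\<V>(A)\<^sup>(\<^sup>n\<^sup>)\<close>.\<close>

definition variety_n ::
    "('f \<Rightarrow> nat) \<Rightarrow> ('f, 'a) ualg \<Rightarrow> nat \<Rightarrow> ('f, 'b) ualg set" where
  "variety_n ar A n =
     {B. is_algebra ar B \<and>
         (\<forall>p \<in> identities_upto ar n. satisfies A p \<longrightarrow> satisfies B p)}"

inductive_set subuniverse_gen :: "('f \<Rightarrow> nat) \<Rightarrow> ('f, 'a) ualg \<Rightarrow> 'a set \<Rightarrow> 'a set"
  for ar :: "'f \<Rightarrow> nat" and A :: "('f, 'a) ualg" and X :: "'a set" where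
  base: "x \<in> X \<Longrightarrow> x \<in> subuniverse_gen ar A X"
| step: "length xs = ar f \<Longrightarrow> (\<forall>x \<in> set xs. x \<in> subuniverse_gen ar A X) \<Longrightarrow>
           oper A f xs \<in> subuniverse_gen ar A X"

definition generated_by_at_most :: "('f \<Rightarrow> nat) \<Rightarrow> nat \<Rightarrow> ('f, 'a) ualg \<Rightarrow> bool" where
  "generated_by_at_most ar d A \<longleftrightarrow>
     (\<exists>X \<subseteq> universe A. finite X \<and> card X \<le> d \<and> subuniverse_gen ar A X = universe A)"

definition arbitrarily_large_finite_gen ::
    "('f \<Rightarrow> nat) \<Rightarrow> nat \<Rightarrow> ('f, 'a) ualg set \<Rightarrow> bool" where
  "arbitrarily_large_finite_gen ar d K \<longleftrightarrow>
     (\<forall>l > 0. \<exists>B \<in> K. finite (universe B) \<and> generated_by_at_most ar d B \<and>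
        card (universe B) \<ge> l)"

text \<open>Only finite members of the class matter here, and up to isomorphism these have a
  set of natural numbers as universe; hence the carrier type \<open>nat\<close> loses no generality.\<close>

definition inherently_nonfinitely_based_fin ::
    "('f :: finite \<Rightarrow> nat) \<Rightarrow> ('f, 'a) ualg \<Rightarrow> bool" where
  "inherently_nonfinitely_based_fin ar A \<longleftrightarrow>
     (\<forall>n \<ge> 1. \<exists>d \<ge> 1.
        arbitrarily_large_finite_gen ar d (variety_n ar A n :: ('f, nat) ualg set))"

datatype fd_sym = F_sym | D_sym

instance fd_sym :: finite
proof
  have "(UNIV :: fd_sym set) = {F_sym, D_sym}"
    using fd_sym.exhaust by auto
  then show "finite (UNIV :: fd_sym set)"
    by (metis finite.emptyI finite_insert)
qed

primrec fd_arity :: "fd_sym \<Rightarrow> nat" where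
  "fd_arity F_sym = 1"
| "fd_arity D_sym = 2"

fun action_oper :: "('g \<Rightarrow> 's \<Rightarrow> 's) \<Rightarrow> fd_sym \<Rightarrow> ('g \<times> 's) list \<Rightarrow> 'g \<times> 's" where
  "action_oper \<alpha> F_sym [(g, s)] = (g, \<alpha> g s)"
| "action_oper \<alpha> D_sym [(g1, s1), (g2, s2)] = (g1, s2)"
| "action_oper \<alpha> _ _ = undefined"

definition action_algebra ::
    "('g, 'm) monoid_scheme \<Rightarrow> 's set \<Rightarrow> ('g \<Rightarrow> 's \<Rightarrow> 's) \<Rightarrow> (fd_sym, 'g \<times> 's) ualg" where
  "action_algebra G S \<alpha> = \<lparr>universe = carrier G \<times> S, oper = action_oper \<alpha>\<rparr>"

lemma is_algebra_action_algebra: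
  assumes "group_action G S \<alpha>" "S \<noteq> {}"
  shows "is_algebra fd_arity (action_algebra G S \<alpha>)"
proof -
  interpret group_action G S \<alpha> by fact
  have ne: "carrier G \<noteq> {}"
    using group_hom group_hom.axioms(1) group.is_monoid monoid.one_closed by fastforce
  have "action_oper \<alpha> f xs \<in> carrier G \<times> S"
    if "length xs = fd_arity f" "set xs \<subseteq> carrier G \<times> S" for f xs
  proof (cases f)
    case F_sym
    with that obtain g s where "xs = [(g, s)]"
      by (auto simp: length_Suc_conv)
    with that F_sym show ?thesis
      using element_image by auto
  next
    case D_sym
    with that obtain g s h t where "xs = [(g, s), (h, t)]"
      by (auto simp: length_Suc_conv numeral_2_eq_2)
    with that D_sym show ?thesis by auto
  qed
  with ne assms(2) show ?thesis
    by (auto simp: is_algebra_def action_algebra_def)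
qed

end

theory Submission
  imports
    "HOL-Computational_Algebra.Polynomial"
    Defs
    "HOL-Algebra.Sylow"
    "HOL-Algebra.Multiplicative_Group"
begin

text \<open>
  In the algebra of a faithful action, a term evaluates to the \<open>G\<close>-component of its first variable
  together with a word in \<open>G\<close>-components applied to the \<open>S\<close>-component of its last variable. So an
  identity amounts to a semigroup law of \<open>G\<close>, and any \<open>n + 1\<close> permutations of a set, every \<open>n\<close> of
  which satisfy the laws of \<open>G\<close>, yield an algebra satisfying the \<open>n\<close>-variable identities.

  A finite nonnilpotent group has a section containing an elementary abelian \<open>p\<close>-group \<open>V\<close> and an
  element \<open>g\<close> inducing on \<open>V\<close> an automorphism of prime order \<open>q \<noteq> p\<close>. Fourier inversion over
  \<open>\<int>/q\<close> in the module \<open>V\<close> shows that all laws of \<open>G\<close> hold in the wreath products of \<open>\<int>/p\<close> with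
  \<open>(\<int>/q)\<^sup>m\<close>.

  Now let \<open>\<sigma>\<^sub>1, \<dots>, \<sigma>\<^sub>n\<close> act on \<open>\<Omega> \<times> (\<int>/q)\<^sup>n\<close> by unit translations of the second factor, and let \<open>u\<close>
  act as \<open>x\<close> on the fibre over \<open>0\<close>, as \<open>y\<close> on the fibre over \<open>(1, \<dots>, 1)\<close> and trivially elsewhere,
  where \<open>x\<close> and \<open>y\<close> are permutations of \<open>\<Omega>\<close> of order \<open>p\<close>. Conjugates of \<open>u\<close> by words omitting
  some \<open>\<sigma>\<^sub>k\<close> commute, so any \<open>n\<close> of these \<open>n + 1\<close> permutations satisfy the laws of the wreath
  product; but \<open>x\<close> and \<open>y\<close> can be chosen to generate a transitive group on an arbitrarily large
  finite \<open>\<Omega>\<close>.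
\<close>

subsection \<open>Normal forms of terms\<close>

text \<open>The evaluation clause is stated for two type instances, since the same normal form is needed
  in two algebras over different carrier types.\<close>

lemma term_normal_form:
  assumes "wf_trm fd_arity t"
  shows "\<exists>h w l. {h, l} \<union> set w \<subseteq> trm_vars t \<and>
    (\<forall>U (\<beta> :: 'p \<Rightarrow> 'q \<Rightarrow> 'q) e. eval_trm \<lparr>universe = U, oper = action_oper \<beta>\<rparr> e t =
       (fst (e h), foldr (\<lambda>i. \<beta> (fst (e i))) w (snd (e l)))) \<and>
    (\<forall>U (\<beta> :: 'r \<Rightarrow> 's \<Rightarrow> 's) e. eval_trm \<lparr>universe = U, oper = action_oper \<beta>\<rparr> e t =
       (fst (e h), foldr (\<lambda>i. \<beta> (fst (e i))) w (snd (e l))))"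
  using assms
proof (induction t)
  case (Var x)
  show ?case by (intro exI[of _ x] exI[of _ "[]"]) auto
next
  case (App f ts)
  show ?case
  proof (cases f)
    case F_sym
    with App.prems obtain t where t: "ts = [t]" "wf_trm fd_arity t"
      by (auto simp: length_Suc_conv)
    from App.IH[of t] t obtain h w l where
      "{h, l} \<union> set w \<subseteq> trm_vars t"
      "\<forall>U (\<beta> :: 'p \<Rightarrow> 'q \<Rightarrow> 'q) e. eval_trm \<lparr>universe = U, oper = action_oper \<beta>\<rparr> e t =
         (fst (e h), foldr (\<lambda>i. \<beta> (fst (e i))) w (snd (e l)))"
      "\<forall>U (\<beta> :: 'r \<Rightarrow> 's \<Rightarrow> 's) e. eval_trm \<lparr>universe = U, oper = action_oper \<beta>\<rparr> e t =
         (fst (e h), foldr (\<lambda>i. \<beta> (fst (e i))) w (snd (e l)))" by auto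
    then show ?thesis
      by (intro exI[of _ h] exI[of _ "h # w"] exI[of _ l]) (auto simp: t F_sym)
  next
    case D_sym
    with App.prems obtain s t where st: "ts = [s, t]" "wf_trm fd_arity s" "wf_trm fd_arity t"
      by (auto simp: length_Suc_conv numeral_2_eq_2)
    from App.IH[of s] st obtain h w l where
      1: "{h, l} \<union> set w \<subseteq> trm_vars s"
      "\<forall>U (\<beta> :: 'p \<Rightarrow> 'q \<Rightarrow> 'q) e. eval_trm \<lparr>universe = U, oper = action_oper \<beta>\<rparr> e s =
         (fst (e h), foldr (\<lambda>i. \<beta> (fst (e i))) w (snd (e l)))"
      "\<forall>U (\<beta> :: 'r \<Rightarrow> 's \<Rightarrow> 's) e. eval_trm \<lparr>universe = U, oper = action_oper \<beta>\<rparr> e s =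
         (fst (e h), foldr (\<lambda>i. \<beta> (fst (e i))) w (snd (e l)))" by auto
    from App.IH[of t] st obtain h' w' l' where
      2: "{h', l'} \<union> set w' \<subseteq> trm_vars t"
      "\<forall>U (\<beta> :: 'p \<Rightarrow> 'q \<Rightarrow> 'q) e. eval_trm \<lparr>universe = U, oper = action_oper \<beta>\<rparr> e t =
         (fst (e h'), foldr (\<lambda>i. \<beta> (fst (e i))) w' (snd (e l')))"
      "\<forall>U (\<beta> :: 'r \<Rightarrow> 's \<Rightarrow> 's) e. eval_trm \<lparr>universe = U, oper = action_oper \<beta>\<rparr> e t =
         (fst (e h'), foldr (\<lambda>i. \<beta> (fst (e i))) w' (snd (e l')))" by auto
    from 1 2 show ?thesis
      by (intro exI[of _ h] exI[of _ "w'"] exI[of _ l']) (auto simp: st D_sym)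
  qed
qed

section \<open>Semigroup words and laws of groups\<close>

definition word_eval :: "('g, 'm) monoid_scheme \<Rightarrow> (nat \<Rightarrow> 'g) \<Rightarrow> nat list \<Rightarrow> 'g" where
  "word_eval G \<gamma> w = foldr (\<lambda>i r. \<gamma> i \<otimes>\<^bsub>G\<^esub> r) w \<one>\<^bsub>G\<^esub>"

text \<open>Words contain no inverses, because the operation \<open>f\<close> only ever applies the
  group elements themselves.\<close>

definition group_law :: "('g, 'm) monoid_scheme \<Rightarrow> nat list \<Rightarrow> nat list \<Rightarrow> bool" where
  "group_law G w w' \<longleftrightarrow>
     (\<forall>\<gamma>. range \<gamma> \<subseteq> carrier G \<longrightarrow> word_eval G \<gamma> w = word_eval G \<gamma> w')"

lemma word_eval_simps [simp]:
  "word_eval G \<gamma> [] = \<one>\<^bsub>G\<^esub>"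
  "word_eval G \<gamma> (i # w) = \<gamma> i \<otimes>\<^bsub>G\<^esub> word_eval G \<gamma> w"
  by (simp_all add: word_eval_def)

lemma (in monoid) word_eval_closed [simp]:
  "range \<gamma> \<subseteq> carrier G \<Longrightarrow> word_eval G \<gamma> w \<in> carrier G"
  by (induction w) (auto simp: image_subset_iff)

lemma word_eval_map: "word_eval G \<gamma> (map \<rho> w) = word_eval G (\<gamma> \<circ> \<rho>) w"
  by (induction w) auto

lemma group_law_map:
  assumes "group_law G w w'"
  shows "group_law G (map \<rho> w) (map \<rho> w')"
  using assms unfolding group_law_def word_eval_map by (auto simp: image_subset_iff)

lemma (in group_action) foldr_action:
  assumes "range \<gamma> \<subseteq> carrier G" "s \<in> E"
  shows "foldr (\<lambda>i. \<phi> (\<gamma> i)) w s = \<phi> (word_eval G \<gamma> w) s"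
proof -
  interpret group G using group_hom by (simp add: group_hom_def)
  show ?thesis
  proof (induction w)
    case Nil
    from assms show ?case using id_eq_one by (metis foldr.simps(1) id_apply restrict_apply word_eval_simps(1))
  next
    case (Cons i w)
    with assms show ?case by (simp add: composition_rule image_subset_iff)
  qed
qed

lemma (in faithful_action) separating_point:
  assumes "g \<in> carrier G" "h \<in> carrier G" "g \<noteq> h"
  shows "\<exists>s \<in> E. \<phi> g s \<noteq> \<phi> h s"
proof (rule ccontr)
  assume "\<not> ?thesis"
  \<comment> \<open>Faithfulness is injectivity into functions that are \<open>undefined\<close> off
    \<open>E\<close>, so agreement on \<open>E\<close> already makes two of them equal.\<close>
  moreover have "\<phi> g \<in> extensional E" "\<phi> h \<in> extensional E"
    using assms bij_prop0 by (auto simp: Bij_def)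
  ultimately have "\<phi> g = \<phi> h" by (intro extensionalityI[of _ E]) auto
  with assms faithful show False by (auto dest: inj_onD)
qed

text \<open>Special assignments recover the normal form: two elements of \<open>G\<close> separate
  first variables, and two points of \<open>S\<close> separate last ones. What remains is a pair of
  words acting alike on all of \<open>S\<close>, which faithfulness turns into a law. The type of
  \<open>\<beta>\<close> is independent of \<open>G\<close> and \<open>S\<close>, so that the same
  words can be read in the new algebra.\<close>

lemma identity_normal_form:
  fixes G :: "('g, 'm) monoid_scheme" (structure) and S :: "'s set"
  assumes "faithful_action G S \<alpha>" "carrier G \<noteq> {\<one>}"
    and "wf_trm fd_arity s" "wf_trm fd_arity t" "satisfies (action_algebra G S \<alpha>) (s, t)"
  shows "\<exists>h w w' l. {h, l} \<union> set w \<union> set w' \<subseteq> trm_vars s \<union> trm_vars t \<and> group_law G w w' \<and>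
    (\<forall>U (\<beta> :: 'p \<Rightarrow> 'q \<Rightarrow> 'q) e.
       eval_trm \<lparr>universe = U, oper = action_oper \<beta>\<rparr> e s =
         (fst (e h), foldr (\<lambda>i. \<beta> (fst (e i))) w (snd (e l))) \<and>
       eval_trm \<lparr>universe = U, oper = action_oper \<beta>\<rparr> e t =
         (fst (e h), foldr (\<lambda>i. \<beta> (fst (e i))) w' (snd (e l))))"
proof -
  interpret faithful_action G S \<alpha> by fact
  interpret group G using group_hom by (simp add: group_hom_def)
  obtain g where g: "g \<in> carrier G" "g \<noteq> \<one>" using assms(2) by auto
  obtain a where a: "a \<in> S" "\<alpha> g a \<noteq> \<alpha> \<one> a" using separating_point[of g \<one>] g by auto
  then obtain b where b: "b \<in> S" "b \<noteq> a" using element_image[of _ a] g one_closed by metis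
  from term_normal_form[OF assms(3)] obtain h w l where
    s: "{h, l} \<union> set w \<subseteq> trm_vars s"
      "\<And>U (\<beta> :: 'p \<Rightarrow> 'q \<Rightarrow> 'q) e. eval_trm \<lparr>universe = U, oper = action_oper \<beta>\<rparr> e s =
         (fst (e h), foldr (\<lambda>i. \<beta> (fst (e i))) w (snd (e l)))"
      "\<And>U (\<beta> :: 'g \<Rightarrow> 's \<Rightarrow> 's) e. eval_trm \<lparr>universe = U, oper = action_oper \<beta>\<rparr> e s =
         (fst (e h), foldr (\<lambda>i. \<beta> (fst (e i))) w (snd (e l)))" by blast
  from term_normal_form[OF assms(4)] obtain h' w' l' where
    t: "{h', l'} \<union> set w' \<subseteq> trm_vars t"
      "\<And>U (\<beta> :: 'p \<Rightarrow> 'q \<Rightarrow> 'q) e. eval_trm \<lparr>universe = U, oper = action_oper \<beta>\<rparr> e t =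
         (fst (e h'), foldr (\<lambda>i. \<beta> (fst (e i))) w' (snd (e l')))"
      "\<And>U (\<beta> :: 'g \<Rightarrow> 's \<Rightarrow> 's) e. eval_trm \<lparr>universe = U, oper = action_oper \<beta>\<rparr> e t =
         (fst (e h'), foldr (\<lambda>i. \<beta> (fst (e i))) w' (snd (e l')))" by blast
  have eq: "\<gamma> h = \<gamma> h'"
    "\<alpha> (word_eval G \<gamma> w) (\<sigma> l) = \<alpha> (word_eval G \<gamma> w') (\<sigma> l')"
    if "range \<gamma> \<subseteq> carrier G" "range \<sigma> \<subseteq> S" for \<gamma> \<sigma>
  proof -
    have "range (\<lambda>i. (\<gamma> i, \<sigma> i)) \<subseteq> carrier G \<times> S"
      using that by auto
    with assms(5) have "eval_trm (action_algebra G S \<alpha>) (\<lambda>i. (\<gamma> i, \<sigma> i)) s =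
        eval_trm (action_algebra G S \<alpha>) (\<lambda>i. (\<gamma> i, \<sigma> i)) t"
      by (auto simp: satisfies_def action_algebra_def)
    moreover have "\<sigma> l \<in> S" "\<sigma> l' \<in> S" using that by auto
    ultimately show "\<gamma> h = \<gamma> h'"
      "\<alpha> (word_eval G \<gamma> w) (\<sigma> l) = \<alpha> (word_eval G \<gamma> w') (\<sigma> l')"
      using that by (auto simp: action_algebra_def s(3) t(3) foldr_action)
  qed
  have one: "word_eval G (\<lambda>_. \<one>) v = \<one>" for v by (induction v) auto
  have idS: "\<alpha> \<one> x = x" if "x \<in> S" for x using id_eq_one that by (metis restrict_apply)
  have h: "h' = h"
    using eq(1)[of "\<lambda>i. if i = h then g else \<one>" "\<lambda>_. a"] g a(1)
    by (auto simp: image_subset_iff split: if_splits)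
  \<comment> \<open>Identity elements in all first components erase the words and leave only the
    last variables to compare.\<close>
  have l: "l' = l"
    using eq(2)[of "\<lambda>_. \<one>" "\<lambda>i. if i = l then a else b"] g a(1) b
    by (auto simp: one idS image_subset_iff split: if_splits)
  have "group_law G w w'"
    unfolding group_law_def
  proof (intro allI impI)
    fix \<gamma> :: "nat \<Rightarrow> 'g" assume \<gamma>: "range \<gamma> \<subseteq> carrier G"
    show "word_eval G \<gamma> w = word_eval G \<gamma> w'"
    proof (rule ccontr)
      assume "word_eval G \<gamma> w \<noteq> word_eval G \<gamma> w'"
      then obtain x where "x \<in> S" "\<alpha> (word_eval G \<gamma> w) x \<noteq> \<alpha> (word_eval G \<gamma> w') x"
        using separating_point \<gamma> by (meson word_eval_closed)
      with eq(2)[OF \<gamma>, of "\<lambda>_. x"] show False by auto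
    qed
  qed
  with s(1,2) t(1,2) show ?thesis
    unfolding h l by (intro exI[of _ h] exI[of _ w] exI[of _ w'] exI[of _ l]) auto
qed

subsection \<open>Transport to the natural numbers\<close>

lemma is_algebraD:
  assumes "is_algebra ar A" "length xs = ar f" "set xs \<subseteq> universe A"
  shows "oper A f xs \<in> universe A"
  using assms unfolding is_algebra_def by blast

lemma eval_trm_closed:
  assumes "is_algebra ar A" "range e \<subseteq> universe A" "wf_trm ar t"
  shows "eval_trm A e t \<in> universe A"
  using assms(3)
proof (induction t)
  case (App f ts)
  then show ?case
    by (auto intro!: is_algebraD[OF assms(1)] simp: list_all_iff)
qed (use assms in auto)

definition image_algebra :: "('a \<Rightarrow> 'b) \<Rightarrow> ('f, 'a) ualg \<Rightarrow> ('f, 'b) ualg" where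
  "image_algebra \<phi> A = \<lparr>universe = \<phi> ` universe A,
     oper = (\<lambda>f xs. \<phi> (oper A f (map (inv_into (universe A) \<phi>) xs)))\<rparr>"

context
  fixes ar :: "'f \<Rightarrow> nat" and A :: "('f, 'a) ualg" and \<phi> :: "'a \<Rightarrow> 'b"
  assumes A: "is_algebra ar A" and inj: "inj_on \<phi> (universe A)"
begin

lemma is_algebra_image_algebra: "is_algebra ar (image_algebra \<phi> A)"
proof -
  have "oper (image_algebra \<phi> A) f xs \<in> universe (image_algebra \<phi> A)"
    if "length xs = ar f" "set xs \<subseteq> universe (image_algebra \<phi> A)" for f xs
    using that by (auto simp: image_algebra_def subset_iff
        intro!: imageI is_algebraD[OF A] inv_into_into)
  with A show ?thesis by (auto simp: is_algebra_def image_algebra_def)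
qed

lemma eval_trm_image_algebra:
  assumes "range e \<subseteq> universe A" "wf_trm ar t"
  shows "eval_trm (image_algebra \<phi> A) (\<lambda>i. \<phi> (e i)) t = \<phi> (eval_trm A e t)"
  using assms(2)
proof (induction t)
  case (App f ts)
  have "inv_into (universe A) \<phi> (eval_trm (image_algebra \<phi> A) (\<lambda>i. \<phi> (e i)) t) = eval_trm A e t"
    if "t \<in> set ts" for t
    using App.prems that
    by (simp add: App.IH list_all_iff inv_into_f_f[OF inj] eval_trm_closed[OF A assms(1)])
  then have "map (inv_into (universe A) \<phi>) (map (eval_trm (image_algebra \<phi> A) (\<lambda>i. \<phi> (e i))) ts) =
      map (eval_trm A e) ts" by simp
  moreover have "oper (image_algebra \<phi> A) f xs = \<phi> (oper A f (map (inv_into (universe A) \<phi>) xs))"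
    for xs by (simp add: image_algebra_def)
  ultimately show ?case by (simp only: eval_trm.simps)
qed auto

lemma satisfies_image_algebra:
  assumes "wf_trm ar s" "wf_trm ar t" "satisfies A (s, t)"
  shows "satisfies (image_algebra \<phi> A) (s, t)"
  unfolding satisfies_def
proof (intro allI impI)
  fix e' :: "nat \<Rightarrow> 'b" assume e': "range e' \<subseteq> universe (image_algebra \<phi> A)"
  define e where "e = inv_into (universe A) \<phi> \<circ> e'"
  have "range e \<subseteq> universe A"
    using e' by (auto simp: e_def image_algebra_def image_subset_iff intro!: inv_into_into)
  moreover have "e' = (\<lambda>i. \<phi> (e i))"
    using e' by (auto simp: e_def image_algebra_def image_subset_iff f_inv_into_f)
  ultimately show "eval_trm (image_algebra \<phi> A) e' (fst (s, t)) =
      eval_trm (image_algebra \<phi> A) e' (snd (s, t))"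
    using assms by (auto simp: eval_trm_image_algebra satisfies_def)
qed

lemma subuniverse_gen_image_algebra:
  assumes "X \<subseteq> universe A" "x \<in> subuniverse_gen ar A X"
  shows "x \<in> universe A \<and> \<phi> x \<in> subuniverse_gen ar (image_algebra \<phi> A) (\<phi> ` X)"
  using assms(2)
proof (induction rule: subuniverse_gen.induct)
  case (base x)
  then show ?case using assms(1) by (auto intro: subuniverse_gen.base)
next
  case (step xs f)
  have "map (inv_into (universe A) \<phi>) (map \<phi> xs) = xs"
    using step by (auto simp: inv_into_f_f[OF inj] intro: map_idI)
  moreover have "oper (image_algebra \<phi> A) f (map \<phi> xs)
      \<in> subuniverse_gen ar (image_algebra \<phi> A) (\<phi> ` X)"
    using step by (intro subuniverse_gen.step) auto
  ultimately have "\<phi> (oper A f xs) \<in> subuniverse_gen ar (image_algebra \<phi> A) (\<phi> ` X)"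
    by (simp add: image_algebra_def)
  moreover have "oper A f xs \<in> universe A" using step by (intro is_algebraD[OF A]) auto
  ultimately show ?case by blast
qed

lemma subuniverse_gen_subset:
  assumes "X \<subseteq> universe A"
  shows "subuniverse_gen ar A X \<subseteq> universe A"
  using subuniverse_gen_image_algebra[OF assms] by blast

end

lemma generated_by_image_algebra:
  assumes "is_algebra ar A" "inj_on \<phi> (universe A)" "generated_by_at_most ar d A"
  shows "generated_by_at_most ar d (image_algebra \<phi> A)"
proof -
  from assms(3) obtain X where X: "X \<subseteq> universe A" "finite X" "card X \<le> d"
    "subuniverse_gen ar A X = universe A" by (auto simp: generated_by_at_most_def)
  let ?B = "image_algebra \<phi> A"
  have X': "\<phi> ` X \<subseteq> universe ?B" using X(1) by (auto simp: image_algebra_def)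
  have "subuniverse_gen ar ?B (\<phi> ` X) \<subseteq> universe ?B"
    \<comment> \<open>Here the injection fixed by the context is instantiated with the
      identity.\<close>
    by (rule subuniverse_gen_subset[OF is_algebra_image_algebra[OF assms(1,2)] inj_on_id X'])
  moreover have "universe ?B \<subseteq> subuniverse_gen ar ?B (\<phi> ` X)"
    using subuniverse_gen_image_algebra[OF assms(1,2) X(1)] X(4) by (auto simp: image_algebra_def)
  moreover have "card (\<phi> ` X) \<le> d" using X card_image_le order_trans by blast
  ultimately show ?thesis using X(2) X' unfolding generated_by_at_most_def by blast
qed

text \<open>Relabelling along an injection into \<open>nat\<close> preserves membership in the
  class, generation and size, so witnesses may be built over any convenient carrier type.\<close>

lemma arbitrarily_large_finite_gen_natI:
  assumes "\<And>l. \<exists>B :: ('f, 'b) ualg. B \<in> variety_n ar A n \<and> finite (universe B) \<and>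
      generated_by_at_most ar d B \<and> card (universe B) \<ge> l"
  shows "arbitrarily_large_finite_gen ar d (variety_n ar A n :: ('f, nat) ualg set)"
  unfolding arbitrarily_large_finite_gen_def
proof (intro allI impI)
  fix l :: nat
  from assms[of l] obtain B :: "('f, 'b) ualg" where B: "B \<in> variety_n ar A n" "finite (universe B)"
    "generated_by_at_most ar d B" "card (universe B) \<ge> l" by blast
  obtain \<phi> :: "'b \<Rightarrow> nat" where \<phi>: "inj_on \<phi> (universe B)"
    using finite_imp_inj_to_nat_seg[OF B(2)] by blast
  have alg: "is_algebra ar B" using B(1) by (simp add: variety_n_def)
  have "image_algebra \<phi> B \<in> variety_n ar A n"
    using B(1) is_algebra_image_algebra[OF alg \<phi>] satisfies_image_algebra[OF alg \<phi>]
    by (auto simp: variety_n_def identities_upto_def)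
  moreover have "universe (image_algebra \<phi> B) = \<phi> ` universe B"
    by (simp add: image_algebra_def)
  moreover have "card (\<phi> ` universe B) = card (universe B)" by (rule card_image[OF \<phi>])
  ultimately show "\<exists>B \<in> variety_n ar A n :: ('f, nat) ualg set. finite (universe B) \<and>
      generated_by_at_most ar d B \<and> l \<le> card (universe B)"
    using B generated_by_image_algebra[OF alg \<phi> B(3)]
    by (intro bexI[of _ "image_algebra \<phi> B"]) auto
qed

subsection \<open>Large algebras generated by few elements\<close>

text \<open>The wreath product of \<open>\<int>/p\<close> with \<open>(\<int>/q)\<^sup>m\<close> is generated by the letter \<open>0\<close> (for the base group)
  and the letters \<open>i \<ge> 1\<close> (for the top group). The coordinate at \<open>a\<close> of the base part of a word is
  the number of occurrences of \<open>0\<close> followed by a suffix with exponent vector \<open>a\<close>.\<close>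

definition exponents :: "nat \<Rightarrow> nat list \<Rightarrow> nat \<Rightarrow> nat" where
  "exponents q w = (\<lambda>i. if i = 0 then 0 else count_list w i mod q)"

primrec occurrences :: "nat \<Rightarrow> (nat \<Rightarrow> nat) \<Rightarrow> nat list \<Rightarrow> nat" where
  "occurrences q a [] = 0"
| "occurrences q a (l # w) = occurrences q a w + (if l = 0 \<and> exponents q w = a then 1 else 0)"

text \<open>Only the values at the generators are compared. Later the variables of an identity are
  renamed to letters, and \<open>group_law_map\<close> shows that laws survive renaming. The
  conditions on \<open>a\<close> describe the possible exponent vectors.\<close>

definition wreath_law :: "nat \<Rightarrow> nat \<Rightarrow> nat list \<Rightarrow> nat list \<Rightarrow> bool" where
  "wreath_law p q w w' \<longleftrightarrow>
     (\<forall>i. count_list w i mod q = count_list w' i mod q) \<and>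
     (\<forall>a. finite {i. a i \<noteq> 0} \<longrightarrow> a 0 = 0 \<longrightarrow> (\<forall>i. a i < q) \<longrightarrow>
        occurrences q a w mod p = occurrences q a w' mod p)"

section \<open>Permutations of a bundle over \<open>(\<int>/q)\<^sup>n\<close>\<close>

locale fibre_action =
  fixes p q L n :: nat
  assumes p: "2 \<le> p" and q: "2 \<le> q" and n: "1 \<le> n"
begin

text \<open>The permutation \<open>x\<close>: a product of \<open>L\<close> disjoint
  \<open>p\<close>-cycles on consecutive blocks of length \<open>p\<close>.\<close>

definition rot :: "nat \<Rightarrow> nat" where
  "rot i = (if i < p * L then p * (i div p) + (i + 1) mod p else i)"

text \<open>The permutation \<open>y\<close>: \<open>rot\<close> moved up by one, with
  \<open>0\<close> fixed, so that its blocks straddle the block boundaries of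
  \<open>rot\<close>.\<close>

definition rot' :: "nat \<Rightarrow> nat" where
  "rot' i = (case i of 0 \<Rightarrow> 0 | Suc j \<Rightarrow> Suc (rot j))"

definition ones :: "nat \<Rightarrow> nat" where
  "ones i = (if 1 \<le> i \<and> i \<le> n then 1 else 0)"

text \<open>Letter \<open>0\<close> acts as \<open>u\<close>, and letter \<open>i\<close> in
  \<open>{1..n}\<close> as the \<open>i\<close>-th unit translation. Larger letters would leave
  \<open>vectors\<close>, whence the bound in \<open>act_closed\<close>.\<close>

fun act :: "nat \<Rightarrow> nat \<times> (nat \<Rightarrow> nat) \<Rightarrow> nat \<times> (nat \<Rightarrow> nat)" where
  "act i (x, e) =
     (if i = 0 then (if e = (\<lambda>_. 0) then rot x else if e = ones then rot' x else x, e)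
      else (x, e(i := (e i + 1) mod q)))"

definition vectors :: "(nat \<Rightarrow> nat) set" where
  "vectors = {e. \<forall>i. e i < q \<and> (i \<notin> {1..n} \<longrightarrow> e i = 0)}"

lemma rot_funpow:
  assumes "i < p * L"
  shows "(rot ^^ k) i = p * (i div p) + (i + k) mod p"
proof (induction k)
  case 0
  show ?case by simp
next
  case (Suc k)
  let ?j = "p * (i div p) + (i + k) mod p"
  have r: "(i + k) mod p < p" using p by simp
  have "i div p < L" using assms by (simp add: less_mult_imp_div_less mult.commute)
  then have "p * Suc (i div p) \<le> p * L" by (intro mult_le_mono2) simp
  with r have "?j < p * L" by (simp add: algebra_simps)
  moreover have "?j div p = i div p" using r p by simp
  moreover have "(?j + 1) mod p = (i + Suc k) mod p"
    by (simp add: mod_Suc_eq flip: mod_Suc_eq[of "p * (i div p) + (i + k) mod p" p])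
  ultimately show ?case using Suc by (simp add: rot_def)
qed

lemma rot_funpow_period: "(rot ^^ p) i = i"
proof (cases "i < p * L")
  case True
  then show ?thesis by (simp add: rot_funpow)
next
  case False
  then have "(rot ^^ k) i = i" for k by (induction k) (auto simp: rot_def)
  then show ?thesis .
qed

lemma rot'_funpow: "(rot' ^^ k) i = (case i of 0 \<Rightarrow> 0 | Suc j \<Rightarrow> Suc ((rot ^^ k) j))"
  by (induction k) (auto simp: rot'_def split: nat.splits)

lemma rot_funpow_cong: "k mod p = k' mod p \<Longrightarrow> (rot ^^ k) i = (rot ^^ k') i"
  using funpow_mod_eq[OF rot_funpow_period, of k i] funpow_mod_eq[OF rot_funpow_period, of k' i]
  by simp

lemma rot'_funpow_cong: "k mod p = k' mod p \<Longrightarrow> (rot' ^^ k) i = (rot' ^^ k') i"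
  by (cases i) (simp_all add: rot'_funpow rot_funpow_cong[of k k'])

lemma rot_less: "i < p * L \<Longrightarrow> rot i < p * L"
proof -
  assume i: "i < p * L"
  have "(i + 1) mod p < p" using p by simp
  moreover have "i div p < L" using i by (simp add: less_mult_imp_div_less mult.commute)
  then have "p * Suc (i div p) \<le> p * L" by (intro mult_le_mono2) simp
  ultimately show ?thesis using i by (simp add: rot_def)
qed

lemma rot_le: "i \<le> p * L \<Longrightarrow> rot i \<le> p * L"
  by (cases "i < p * L") (auto simp: rot_less less_imp_le, simp add: rot_def)

lemma rot'_le: "i \<le> p * L \<Longrightarrow> rot' i \<le> p * L"
  using rot_less by (auto simp: rot'_def Suc_le_eq split: nat.splits)

lemma rot_eq_Suc:
  assumes "i < p * L" "Suc (i mod p) < p"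
  shows "rot i = Suc i"
proof -
  have "(i + 1) mod p = Suc (i mod p)" using assms(2) by (simp add: mod_Suc)
  then show ?thesis using assms(1) by (simp add: rot_def)
qed

text \<open>The fibre has \<open>p * L + 1\<close> points: the blocks of \<open>rot\<close> end at
  \<open>p * L - 1\<close>, the shifted blocks of \<open>rot'\<close> at
  \<open>p * L\<close>.\<close>

definition space :: "(nat \<times> (nat \<Rightarrow> nat)) set" where
  "space = {..p * L} \<times> vectors"

lemma finite_space: "finite space"
proof -
  have "vectors \<subseteq> {e. \<forall>i. (i \<in> {1..n} \<longrightarrow> e i \<in> {..<q}) \<and> (i \<notin> {1..n} \<longrightarrow> e i = 0)}"
    by (auto simp: vectors_def)
  then have "finite vectors"
    by (rule finite_subset) (intro finite_set_of_finite_funs; simp)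
  then show ?thesis by (simp add: space_def)
qed

lemma act_closed:
  assumes "i \<le> n" "s \<in> space"
  shows "act i s \<in> space"
  using assms q rot_le rot'_le by (cases s) (auto simp: space_def vectors_def)

lemma foldr_act_snd:
  assumes "e \<in> vectors"
  shows "snd (foldr act w (x, e)) = (\<lambda>i. (e i + exponents q w i) mod q)"
proof (induction w)
  case Nil
  then show ?case using assms by (auto simp: exponents_def vectors_def)
next
  case (Cons l w)
  obtain y f where yf: "foldr act w (x, e) = (y, f)" by fastforce
  with Cons have f: "f = (\<lambda>i. (e i + exponents q w i) mod q)" by simp
  show ?case
    by (rule ext) (auto simp: yf f exponents_def mod_simps)
qed

text \<open>Turns the question which fibre a word has reached into one about its exponent vector,
  which is what \<open>occurrences\<close> tests. Subtracting \<open>e i\<close> modulo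
  \<open>q\<close> is written as adding \<open>q - e i\<close>.\<close>

lemma foldr_act_eq_target:
  assumes "e \<in> vectors" "\<And>i. t i < q" "t 0 = 0"
  shows "(\<lambda>i. (e i + exponents q w i) mod q) = t \<longleftrightarrow>
    exponents q w = (\<lambda>i. (t i + (q - e i)) mod q)"
proof -
  have e: "e i < q" "e 0 = 0" for i using assms(1) by (auto simp: vectors_def)
  have x: "exponents q w i < q" "exponents q w 0 = 0" for i using q by (auto simp: exponents_def)
  have "(e i + exponents q w i) mod q = t i \<longleftrightarrow> exponents q w i = (t i + (q - e i)) mod q" for i
  proof
    assume *: "(e i + exponents q w i) mod q = t i"
    have "(t i + (q - e i)) mod q = (e i + exponents q w i + (q - e i)) mod q"
      by (simp add: *[symmetric] mod_simps)
    also have "e i + exponents q w i + (q - e i) = exponents q w i + q" using e(1)[of i] by simp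
    also have "\<dots> mod q = exponents q w i" using x(1)[of i] by simp
    finally show "exponents q w i = (t i + (q - e i)) mod q" by simp
  next
    assume *: "exponents q w i = (t i + (q - e i)) mod q"
    have "(e i + exponents q w i) mod q = (e i + (t i + (q - e i))) mod q"
      by (simp add: * mod_simps)
    also have "e i + (t i + (q - e i)) = t i + q" using e(1)[of i] by simp
    also have "\<dots> mod q = t i" using assms(2)[of i] by simp
    finally show "(e i + exponents q w i) mod q = t i" .
  qed
  then show ?thesis by (auto simp: fun_eq_iff)
qed

text \<open>A word that omits the letter \<open>k\<close> never changes coordinate \<open>k\<close>, so along it at most one of
  the two special fibres \<open>0\<close> and \<open>ones\<close> is visited.\<close>

lemma foldr_act_fst:
  assumes e: "e \<in> vectors" and k: "k \<in> {1..n}" "k \<notin> set w"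
  shows "fst (foldr act w (x, e)) =
    (if e k = 0 then (rot ^^ occurrences q (\<lambda>i. (q - e i) mod q) w) x
     else if e k = 1 then (rot' ^^ occurrences q (\<lambda>i. (ones i + (q - e i)) mod q) w) x
     else x)"
  using k(2)
proof (induction w)
  case (Cons l w)
  obtain y f where yf: "foldr act w (x, e) = (y, f)" by fastforce
  have f: "f = (\<lambda>i. (e i + exponents q w i) mod q)"
    using foldr_act_snd[OF e, of w x] yf by simp
  have "e k < q" using e by (simp add: vectors_def)
  then have fk: "f k = e k" using Cons.prems k(1) by (auto simp: f exponents_def count_list_0_iff)
  have z: "f = (\<lambda>_. 0) \<longleftrightarrow> exponents q w = (\<lambda>i. (q - e i) mod q)"
    unfolding f using foldr_act_eq_target[OF e, of "\<lambda>_. 0" w] q by simp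
  have o: "f = ones \<longleftrightarrow> exponents q w = (\<lambda>i. (ones i + (q - e i)) mod q)"
    unfolding f using q by (intro foldr_act_eq_target[OF e]) (auto simp: ones_def)
  let ?a = "occurrences q (\<lambda>i. (q - e i) mod q) w"
  let ?b = "occurrences q (\<lambda>i. (ones i + (q - e i)) mod q) w"
  have IH: "y = (if e k = 0 then (rot ^^ ?a) x else if e k = 1 then (rot' ^^ ?b) x else x)"
    using Cons yf by simp
  have ne: "e k \<noteq> 0 \<Longrightarrow> f \<noteq> (\<lambda>_. 0)" "e k \<noteq> 1 \<Longrightarrow> f \<noteq> ones"
    using fk k(1) by (auto simp: ones_def)
  have step: "fst (foldr act (l # w) (x, e)) =
      (if l = 0 \<and> f = (\<lambda>_. 0) then rot y else if l = 0 \<and> f = ones then rot' y else y)"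
    by (simp add: yf)
  have occ: "occurrences q (\<lambda>i. (q - e i) mod q) (l # w) = ?a + (if l = 0 \<and> f = (\<lambda>_. 0) then 1 else 0)"
    "occurrences q (\<lambda>i. (ones i + (q - e i)) mod q) (l # w) = ?b + (if l = 0 \<and> f = ones then 1 else 0)"
    by (simp_all only: occurrences.simps z o)
  consider "e k = 0" | "e k = 1" | "e k \<noteq> 0" "e k \<noteq> 1" by blast
  then show ?case
  proof cases
    case 1
    with ne(2) show ?thesis unfolding step occ IH by simp
  next
    case 2
    with ne(1) show ?thesis unfolding step occ IH by simp
  next
    case 3
    with ne show ?thesis unfolding step occ IH by simp
  qed
qed simp

lemma foldr_act_fst_no_0: "0 \<notin> set w \<Longrightarrow> fst (foldr act w (x, e)) = x"
proof (induction w)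
  case (Cons l w)
  then show ?case by (cases "foldr act w (x, e)") auto
qed simp

text \<open>If the missing letter is \<open>0\<close>, the fibre coordinate never changes. Otherwise
  \<open>foldr_act_fst\<close> expresses it as a power of \<open>rot\<close> or \<open>rot'\<close>
  whose exponent counts occurrences; the law fixes this count modulo \<open>p\<close>, which is a
  period of both permutations.\<close>

lemma foldr_act_eq:
  assumes law: "wreath_law p q w w'" and k: "k \<le> n" "k \<notin> set w" "k \<notin> set w'"
    and s: "s \<in> space"
  shows "foldr act w s = foldr act w' s"
proof -
  obtain x e where xe: "s = (x, e)" "e \<in> vectors" using s by (auto simp: space_def)
  have cnt: "count_list w i mod q = count_list w' i mod q" for i
    using law by (simp add: wreath_law_def)
  then have ex: "exponents q w = exponents q w'" by (auto simp: exponents_def)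
  have e: "e i < q" "i \<notin> {1..n} \<Longrightarrow> e i = 0" for i using xe(2) by (auto simp: vectors_def)
  \<comment> \<open>The target \<open>t\<close> is \<open>0\<close> or \<open>ones\<close>; its
    vanishing outside \<open>{1..n}\<close> gives the finite support and the value \<open>0\<close>
    at \<open>0\<close> that \<open>wreath_law\<close> asks for.\<close>
  have occ: "occurrences q (\<lambda>i. (t i + (q - e i)) mod q) w mod p =
      occurrences q (\<lambda>i. (t i + (q - e i)) mod q) w' mod p"
    if t: "\<And>i. i \<notin> {1..n} \<Longrightarrow> t i = 0" for t
  proof -
    define a where "a = (\<lambda>i. (t i + (q - e i)) mod q)"
    have a0: "a i = 0" if "i \<notin> {1..n}" for i using that t e(2) by (simp add: a_def)
    have "{i. a i \<noteq> 0} \<subseteq> {1..n}"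
      using a0 by (metis (mono_tags) mem_Collect_eq subsetI)
    then have "finite {i. a i \<noteq> 0}" by (rule finite_subset) simp
    moreover have "a 0 = 0" using a0 by simp
    moreover have "\<forall>i. a i < q" using q by (simp add: a_def)
    moreover have "finite {i. a i \<noteq> 0} \<longrightarrow> a 0 = 0 \<longrightarrow> (\<forall>i. a i < q) \<longrightarrow>
        occurrences q a w mod p = occurrences q a w' mod p"
      by (rule law[unfolded wreath_law_def, THEN conjunct2, THEN spec])
    ultimately show ?thesis unfolding a_def by iprover
  qed
  have "fst (foldr act w s) = fst (foldr act w' s)"
  proof (cases "k = 0")
    case True
    with k show ?thesis by (simp add: xe foldr_act_fst_no_0)
  next
    case False
    with k(1) have k1: "k \<in> {1..n}" by simp
    have "(rot ^^ occurrences q (\<lambda>i. (q - e i) mod q) w) x =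
        (rot ^^ occurrences q (\<lambda>i. (q - e i) mod q) w') x"
      using occ[of "\<lambda>_. 0"] by (intro rot_funpow_cong) simp
    moreover have "(rot' ^^ occurrences q (\<lambda>i. (ones i + (q - e i)) mod q) w) x =
        (rot' ^^ occurrences q (\<lambda>i. (ones i + (q - e i)) mod q) w') x"
      using occ[of ones] by (intro rot'_funpow_cong) (simp add: ones_def)
    ultimately show ?thesis
      unfolding xe(1) foldr_act_fst[OF xe(2) k1 k(2)] foldr_act_fst[OF xe(2) k1 k(3)] by simp
  qed
  moreover have "snd (foldr act w s) = snd (foldr act w' s)"
    by (simp add: xe foldr_act_snd ex)
  ultimately show ?thesis by (rule prod_eqI)
qed

text \<open>The first component is merely an index in \<open>{..n}\<close> of one of the
  \<open>n + 1\<close> permutations; no group needs to be formed from them.\<close>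

definition alg :: "(fd_sym, nat \<times> nat \<times> (nat \<Rightarrow> nat)) ualg" where
  "alg = \<lparr>universe = {..n} \<times> space, oper = action_oper act\<rparr>"

lemma origin_in_space: "(0, \<lambda>_. 0) \<in> space"
  using q by (simp add: space_def vectors_def)

lemma is_algebra_alg: "is_algebra fd_arity alg"
proof -
  have "action_oper act f xs \<in> {..n} \<times> space"
    if "length xs = fd_arity f" "set xs \<subseteq> {..n} \<times> space" for f xs
  proof (cases f)
    case F_sym
    with that obtain g s where "xs = [(g, s)]" by (auto simp: length_Suc_conv)
    with that F_sym show ?thesis using act_closed by auto
  next
    case D_sym
    with that obtain g s h t where "xs = [(g, s), (h, t)]"
      by (auto simp: length_Suc_conv numeral_2_eq_2)
    with that D_sym show ?thesis by auto
  qed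
  with origin_in_space show ?thesis by (auto simp: is_algebra_def alg_def)
qed

lemma card_alg: "L \<le> card (universe alg)"
proof -
  have "inj_on (\<lambda>i. (0 :: nat, i, \<lambda>_ :: nat. 0 :: nat)) {..<L}"
    by (auto simp: inj_on_def)
  moreover have "(\<lambda>i. (0, i, \<lambda>_. 0)) ` {..<L} \<subseteq> universe alg"
  proof -
    have "L \<le> p * L" using p by simp
    then have "i \<le> p * L" if "i < L" for i using that by linarith
    then show ?thesis using origin_in_space by (auto simp: alg_def space_def)
  qed
  moreover have "finite (universe alg)" using finite_space by (simp add: alg_def)
  ultimately show ?thesis by (metis card_image card_lessThan card_mono)
qed

text \<open>The shifted blocks of \<open>rot'\<close> overlap those of \<open>rot\<close>, hence alternating between the two
  fibres reaches every point.\<close>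

lemma generated_alg: "generated_by_at_most fd_arity (Suc n) alg"
proof -
  define X where "X = (\<lambda>i. (i, 0 :: nat, \<lambda>_ :: nat. 0 :: nat)) ` {..n}"
  \<comment> \<open>Since \<open>d\<close> exchanges first components freely, it suffices to follow
    the points that occur with every index.\<close>
  define R where "R = {s. \<forall>i\<le>n. (i, s) \<in> subuniverse_gen fd_arity alg X}"
  have X: "X \<subseteq> universe alg" "finite X" "card X \<le> Suc n"
    using origin_in_space card_image_le[of "{..n}"] by (auto simp: X_def alg_def)
  \<comment> \<open>\<open>f\<close> applies the permutation \<open>i\<close> to \<open>s\<close>,
    and \<open>d\<close> then replaces the index \<open>i\<close> by any \<open>j\<close>.\<close>
  have act_R: "act i s \<in> R" if "i \<le> n" "s \<in> R" for i s
    unfolding R_def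
  proof (intro CollectI allI impI)
    fix j assume "j \<le> n"
    have "oper alg F_sym [(i, s)] \<in> subuniverse_gen fd_arity alg X"
      using that by (intro subuniverse_gen.step) (auto simp: R_def)
    then have "oper alg D_sym [(j, s), (i, act i s)] \<in> subuniverse_gen fd_arity alg X"
      using that \<open>j \<le> n\<close> by (intro subuniverse_gen.step) (auto simp: R_def alg_def)
    then show "(j, act i s) \<in> subuniverse_gen fd_arity alg X" by (simp add: alg_def)
  qed
  have start: "(0, \<lambda>_. 0) \<in> R" by (auto simp: R_def X_def intro: subuniverse_gen.base)
  have coord: "(x, e(i := r)) \<in> R"
    if "(x, e) \<in> R" "e \<in> vectors" "i \<in> {1..n}" "r < q" for x e i r
  proof -
    have it: "(x, e(i := (e i + m) mod q)) \<in> R" for m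
    proof (induction m)
      case 0
      have "e i mod q = e i" using that(2) by (simp add: vectors_def)
      then show ?case using that(1) by simp
    next
      case (Suc m)
      have "act i (x, e(i := (e i + m) mod q)) = (x, e(i := (e i + Suc m) mod q))"
        using that(3) by (auto simp: fun_eq_iff mod_Suc_eq)
      moreover have "act i (x, e(i := (e i + m) mod q)) \<in> R"
        using that(3) by (intro act_R[OF _ Suc]) simp
      ultimately show ?case by (simp only:)
    qed
    \<comment> \<open>Repeated translation only adds, so \<open>r\<close> is reached by adding
      \<open>r + (q - e i)\<close>.\<close>
    have "e i < q" using that(2) by (simp add: vectors_def)
    then have "e i + (r + (q - e i)) = r + q" by simp
    then have "(e i + (r + (q - e i))) mod q = r" using that(4) by simp
    with it[of "r + (q - e i)"] show ?thesis by simp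
  qed
  have move: "(x, e') \<in> R" if "(x, e) \<in> R" "e \<in> vectors" "e' \<in> vectors" for x e e'
  proof -
    \<comment> \<open>Coordinates are corrected one at a time: \<open>?f k\<close> agrees with the
      target on the first \<open>k\<close>.\<close>
    let ?f = "\<lambda>k i. if i \<in> {1..k} then e' i else e i"
    have "k \<le> n \<Longrightarrow> (x, ?f k) \<in> R" for k
    proof (induction k)
      case (Suc k)
      have "?f k \<in> vectors" using that by (auto simp: vectors_def)
      moreover have "e' (Suc k) < q" using that by (simp add: vectors_def)
      ultimately have "(x, (?f k)(Suc k := e' (Suc k))) \<in> R" using Suc by (intro coord) auto
      moreover have "(?f k)(Suc k := e' (Suc k)) = ?f (Suc k)" by (auto simp: fun_eq_iff)
      ultimately show ?case by simp
    qed (use that in simp)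
    from this[of n] have "(x, ?f n) \<in> R" by simp
    moreover have "?f n = e'" using that by (auto simp: fun_eq_iff vectors_def)
    ultimately show ?thesis by simp
  qed
  have vec: "(\<lambda>_. 0) \<in> vectors" "ones \<in> vectors"
    using q by (auto simp: vectors_def ones_def)
  have r: "(rot x, \<lambda>_. 0) \<in> R" if "(x, \<lambda>_. 0) \<in> R" for x
    using act_R[OF _ that, of 0] by simp
  \<comment> \<open>To apply \<open>rot'\<close>, move to the fibre over \<open>ones\<close>, apply
    letter \<open>0\<close> there, and move back.\<close>
  have r': "(rot' x, \<lambda>_. 0) \<in> R" if "(x, \<lambda>_. 0) \<in> R" for x
  proof -
    have "ones 1 = 1" using n by (simp add: ones_def)
    then have "ones \<noteq> (\<lambda>_. 0)" by force
    then have eq: "act 0 (x, ones) = (rot' x, ones)" by simp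
    have "act 0 (x, ones) \<in> R" using move[OF that vec] by (intro act_R) auto
    then show ?thesis unfolding eq by (rule move[OF _ vec(2,1)])
  qed
  have reach: "x \<le> p * L \<Longrightarrow> (x, \<lambda>_. 0) \<in> R" for x
  proof (induction x)
    case (Suc x)
    then have IH: "(x, \<lambda>_. 0) \<in> R" by simp
    show ?case
    proof (cases "Suc (x mod p) < p")
      case True
      with Suc.prems r[OF IH] rot_eq_Suc[of x] show ?thesis by simp
    next
      case False
      \<comment> \<open>Here \<open>x\<close> is the last point of a block of \<open>rot\<close>. As
        \<open>p\<close> is at least \<open>2\<close>, its predecessor \<open>y\<close> is not last
        in a block, so \<open>rot y = x\<close> and \<open>rot'\<close> takes \<open>x\<close> to
        \<open>Suc x\<close>.\<close>
      have "x mod p < p" using p by simp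
      with False have m: "Suc (x mod p) = p" by simp
      then obtain y where y: "x = Suc y" using p by (cases x) auto
      have "Suc (y mod p) < p"
      proof (rule ccontr)
        assume "\<not> Suc (y mod p) < p"
        moreover have "y mod p < p" using p by simp
        ultimately have "x mod p = 0" by (simp add: y mod_Suc)
        with m p show False by simp
      qed
      then have "rot y = x" using Suc.prems by (simp add: y rot_eq_Suc)
      then have "rot' x = Suc x" by (simp add: y rot'_def)
      with r'[OF IH] show ?thesis by simp
    qed
  qed (use start in simp)
  have "universe alg \<subseteq> subuniverse_gen fd_arity alg X"
  proof
    fix s assume "s \<in> universe alg"
    then obtain i x e where s: "s = (i, x, e)" "i \<le> n" "x \<le> p * L" "e \<in> vectors"
      by (auto simp: alg_def space_def)
    have "(x, e) \<in> R" by (rule move[OF reach[OF s(3)] vec(1) s(4)])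
    with s(1,2) show "s \<in> subuniverse_gen fd_arity alg X" by (simp add: R_def)
  qed
  with subuniverse_gen_subset[OF is_algebra_alg inj_on_id X(1)]
  have "subuniverse_gen fd_arity alg X = universe alg" by (rule equalityI)
  with X show ?thesis unfolding generated_by_at_most_def by (intro exI[of _ X]) simp
qed

text \<open>At most \<open>n\<close> variables take at most \<open>n\<close> of the
  \<open>n + 1\<close> indices as first components, so some letter \<open>k\<close> is missing.
  Renaming each variable to its index turns the law of \<open>G\<close> into one between words that
  omit \<open>k\<close>, where \<open>foldr_act_eq\<close> applies.\<close>

lemma alg_in_variety_n:
  fixes G :: "('g, 'm) monoid_scheme" and S :: "'s set"
  assumes "faithful_action G S \<alpha>" "carrier G \<noteq> {\<one>\<^bsub>G\<^esub>}"
    and law: "\<And>w w'. group_law G w w' \<Longrightarrow> wreath_law p q w w'"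
  shows "alg \<in> variety_n fd_arity (action_algebra G S \<alpha>) n"
proof -
  have "satisfies alg (s, t)"
    if st: "wf_trm fd_arity s" "wf_trm fd_arity t" "card (trm_vars s \<union> trm_vars t) \<le> n"
      "satisfies (action_algebra G S \<alpha>) (s, t)" for s t
    unfolding satisfies_def
  proof (intro allI impI)
    fix e :: "nat \<Rightarrow> nat \<times> nat \<times> (nat \<Rightarrow> nat)" assume "range e \<subseteq> universe alg"
    then have e: "fst (e i) \<le> n" "snd (e i) \<in> space" for i
      by (auto simp: alg_def image_subset_iff mem_Times_iff)
    have fin: "finite (trm_vars t)" for t :: "fd_sym trm" by (induction t) auto
    let ?V = "trm_vars s \<union> trm_vars t" and ?\<rho> = "\<lambda>i. fst (e i)"
    obtain h w w' l where nf: "{h, l} \<union> set w \<union> set w' \<subseteq> ?V" "group_law G w w'"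
      "\<And>U (\<beta> :: nat \<Rightarrow> nat \<times> (nat \<Rightarrow> nat) \<Rightarrow> nat \<times> (nat \<Rightarrow> nat)) e.
         eval_trm \<lparr>universe = U, oper = action_oper \<beta>\<rparr> e s =
           (fst (e h), foldr (\<lambda>i. \<beta> (fst (e i))) w (snd (e l))) \<and>
         eval_trm \<lparr>universe = U, oper = action_oper \<beta>\<rparr> e t =
           (fst (e h), foldr (\<lambda>i. \<beta> (fst (e i))) w' (snd (e l)))"
      using identity_normal_form[OF assms(1,2) st(1,2,4)] by blast
    have "card (?\<rho> ` ?V) \<le> n" using card_image_le[of ?V ?\<rho>] fin st(3) by simp
    then have "\<not> {..n} \<subseteq> ?\<rho> ` ?V"
      using card_mono[of "?\<rho> ` ?V" "{..n}"] fin by auto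
    then obtain k where "k \<in> {..n}" "k \<notin> ?\<rho> ` ?V" by blast
    then have k: "k \<le> n" "k \<notin> set (map ?\<rho> w)" "k \<notin> set (map ?\<rho> w')"
      using nf(1) by auto
    have "foldr act (map ?\<rho> w) (snd (e l)) = foldr act (map ?\<rho> w') (snd (e l))"
      by (rule foldr_act_eq[OF law[OF group_law_map[OF nf(2)]] k e(2)])
    then show "eval_trm alg e (fst (s, t)) = eval_trm alg e (snd (s, t))"
      by (simp add: alg_def nf(3) foldr_map comp_def)
  qed
  with is_algebra_alg show ?thesis by (auto simp: variety_n_def identities_upto_def)
qed

end

text \<open>The bound \<open>Suc n\<close> on the generators depends on \<open>n\<close> alone,
  while the number of blocks, here \<open>l\<close>, makes the algebra as large as required.\<close>

lemma inherently_nonfinitely_based_finI: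
  fixes G :: "('g, 'm) monoid_scheme" and S :: "'s set"
  assumes "faithful_action G S \<alpha>" "carrier G \<noteq> {\<one>\<^bsub>G\<^esub>}" "2 \<le> p" "2 \<le> q"
    and "\<And>w w'. group_law G w w' \<Longrightarrow> wreath_law p q w w'"
  shows "inherently_nonfinitely_based_fin fd_arity (action_algebra G S \<alpha>)"
  unfolding inherently_nonfinitely_based_fin_def
proof (intro allI impI)
  fix n :: nat assume n: "n \<ge> 1"
  have "arbitrarily_large_finite_gen fd_arity (Suc n)
      (variety_n fd_arity (action_algebra G S \<alpha>) n :: (fd_sym, nat) ualg set)"
  proof (rule arbitrarily_large_finite_gen_natI)
    fix l :: nat
    interpret fibre_action p q l n using assms n by unfold_locales
    have "finite (universe alg)" using finite_space by (simp add: alg_def)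
    then show "\<exists>B :: (fd_sym, nat \<times> nat \<times> (nat \<Rightarrow> nat)) ualg.
        B \<in> variety_n fd_arity (action_algebra G S \<alpha>) n \<and> finite (universe B) \<and>
        generated_by_at_most fd_arity (Suc n) B \<and> l \<le> card (universe B)"
      using alg_in_variety_n[OF assms(1,2,5)] generated_alg card_alg by blast
  qed
  then show "\<exists>d\<ge>1. arbitrarily_large_finite_gen fd_arity d
      (variety_n fd_arity (action_algebra G S \<alpha>) n :: (fd_sym, nat) ualg set)"
        by (intro exI[of _ "Suc n"]) simp
qed

subsection \<open>Nilpotent groups\<close>

context group
begin

lemma inv_mult_cancel [simp]:
  assumes "x \<in> carrier G" "y \<in> carrier G"
  shows "inv x \<otimes> (x \<otimes> y) = y" "x \<otimes> (inv x \<otimes> y) = y"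
  using assms by (simp_all flip: m_assoc)

lemma subgroup_lower_central: "subgroup (lower_central G n) G"
proof (induction n)
  case 0
  show ?case by (simp add: subgroup_self)
next
  case (Suc n)
  then have "lower_central G n \<subseteq> carrier G" by (rule subgroup.subset)
  then show ?case by (auto intro!: generate_is_subgroup)
qed

lemma nilpotent_trivial: "carrier G = {\<one>} \<Longrightarrow> nilpotent_group G"
  unfolding nilpotent_group_def using is_group by (intro conjI exI[of _ 0]) simp_all

lemma commutator_in_lower_central:
  assumes "x \<in> lower_central G n" "y \<in> carrier G"
  shows "x \<otimes> y \<otimes> inv x \<otimes> inv y \<in> lower_central G (Suc n)"
  using assms by (auto intro!: generate.incl)

text \<open>Take the last term of the lower central series not contained in \<open>H\<close>.
  Commutators of its elements with \<open>H\<close> lie in the next term, hence in \<open>H\<close>,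
  so these elements normalize \<open>H\<close>.\<close>

lemma nilpotent_normalizer_grows:
  assumes "nilpotent_group G" "subgroup H G" "H \<noteq> carrier G"
  shows "\<exists>x \<in> carrier G - H. \<forall>h \<in> H. x \<otimes> h \<otimes> inv x \<in> H"
proof -
  interpret H: subgroup H G by fact
  obtain k where "lower_central G k = {\<one>}" using assms(1) by (auto simp: nilpotent_group_def)
  then have "lower_central G k \<subseteq> H" by simp
  define m where "m = (LEAST n. lower_central G n \<subseteq> H)"
  have m: "lower_central G m \<subseteq> H"
    unfolding m_def by (rule LeastI[where P = "\<lambda>n. lower_central G n \<subseteq> H"]) fact
  have "m \<noteq> 0" using m assms(3) H.subset by auto
  then obtain j where j: "m = Suc j" using not0_implies_Suc by blast
  have "j < (LEAST n. lower_central G n \<subseteq> H)" unfolding m_def[symmetric] j by (rule lessI)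
  then have "\<not> lower_central G j \<subseteq> H" by (rule not_less_Least)
  then obtain x where x: "x \<in> lower_central G j" "x \<notin> H" by blast
  then have xG: "x \<in> carrier G" using subgroup.mem_carrier[OF subgroup_lower_central] by blast
  have "x \<otimes> h \<otimes> inv x \<in> H" if h: "h \<in> H" for h
  proof -
    have "x \<otimes> h \<otimes> inv x \<otimes> inv h \<in> H"
      using commutator_in_lower_central[OF x(1), of h] h m j by auto
    then have "x \<otimes> h \<otimes> inv x \<otimes> inv h \<otimes> h \<in> H"
      using h by (rule H.m_closed)
    then show ?thesis using h xG by (simp add: m_assoc)
  qed
  with x xG show ?thesis by blast
qed

text \<open>The last nontrivial term of the lower central series is central.\<close>

lemma nilpotent_center_nontrivial:
  assumes "nilpotent_group G" "carrier G \<noteq> {\<one>}"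
  shows "\<exists>z \<in> carrier G. z \<noteq> \<one> \<and> (\<forall>y \<in> carrier G. z \<otimes> y = y \<otimes> z)"
proof -
  obtain k where k: "lower_central G k = {\<one>}" using assms(1) by (auto simp: nilpotent_group_def)
  define m where "m = (LEAST n. lower_central G n = {\<one>})"
  have m: "lower_central G m = {\<one>}"
    unfolding m_def by (rule LeastI[where P = "\<lambda>n. lower_central G n = {\<one>}"]) fact
  have "m \<noteq> 0" using m assms(2) by (intro notI) simp
  then obtain j where j: "m = Suc j" using not0_implies_Suc by blast
  have "j < (LEAST n. lower_central G n = {\<one>})" unfolding m_def[symmetric] j by (rule lessI)
  then have "lower_central G j \<noteq> {\<one>}" by (rule not_less_Least)
  moreover have "\<one> \<in> lower_central G j"
    by (rule subgroup.one_closed[OF subgroup_lower_central])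
  ultimately obtain x where x: "x \<in> lower_central G j" "x \<noteq> \<one>" by auto
  then have xG: "x \<in> carrier G" using subgroup.mem_carrier[OF subgroup_lower_central] by blast
  have "x \<otimes> y = y \<otimes> x" if y: "y \<in> carrier G" for y
  proof -
    have "x \<otimes> y \<otimes> inv x \<otimes> inv y \<in> {\<one>}"
      using commutator_in_lower_central[OF x(1) y] unfolding j[symmetric] m .
    then have c: "x \<otimes> y \<otimes> inv x \<otimes> inv y = \<one>" by simp
    have "x \<otimes> y = x \<otimes> y \<otimes> inv x \<otimes> inv y \<otimes> (y \<otimes> x)"
      using xG y by (simp add: m_assoc)
    also have "\<dots> = y \<otimes> x" unfolding c using xG y by simp
    finally show ?thesis .
  qed
  with x xG show ?thesis by (intro bexI[of _ x]) simp_all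
qed

end

text \<open>The lower central series of \<open>G\<close> maps into that of \<open>H\<close>, so some
  term falls into the kernel; as the kernel is central, the next term is trivial. This serves both
  for quotients by the center and for injective copies.\<close>

lemma (in group_hom) nilpotent_if_central_kernel:
  assumes "nilpotent_group H"
    and "\<And>x y. x \<in> carrier G \<Longrightarrow> y \<in> carrier G \<Longrightarrow> h x = \<one>\<^bsub>H\<^esub> \<Longrightarrow> x \<otimes> y = y \<otimes> x"
  shows "nilpotent_group G"
proof -
  have img: "h ` lower_central G n \<subseteq> lower_central H n" for n
  proof (induction n)
    case (Suc n)
    let ?C = "\<Union>x \<in> lower_central G n. \<Union>y \<in> carrier G. {x \<otimes> y \<otimes> inv x \<otimes> inv y}"
    have L: "lower_central G n \<subseteq> carrier G"
      by (rule subgroup.subset[OF G.subgroup_lower_central])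
    then have "?C \<subseteq> carrier G" by auto
    then have "h ` lower_central G (Suc n) = generate H (h ` ?C)" by (simp add: generate_img)
    also have "h ` ?C \<subseteq> (\<Union>x \<in> lower_central H n. \<Union>y \<in> carrier H.
        {x \<otimes>\<^bsub>H\<^esub> y \<otimes>\<^bsub>H\<^esub> inv\<^bsub>H\<^esub> x \<otimes>\<^bsub>H\<^esub> inv\<^bsub>H\<^esub> y})"
    proof
      fix z assume "z \<in> h ` ?C"
      then obtain x y where xy: "x \<in> lower_central G n" "y \<in> carrier G"
        "z = h (x \<otimes> y \<otimes> inv x \<otimes> inv y)" by auto
      then have "z = h x \<otimes>\<^bsub>H\<^esub> h y \<otimes>\<^bsub>H\<^esub> inv\<^bsub>H\<^esub> h x \<otimes>\<^bsub>H\<^esub> inv\<^bsub>H\<^esub> h y"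
        using L by auto
      moreover have "h x \<in> lower_central H n" "h y \<in> carrier H" using Suc xy by auto
      ultimately show "z \<in> (\<Union>x \<in> lower_central H n. \<Union>y \<in> carrier H.
        {x \<otimes>\<^bsub>H\<^esub> y \<otimes>\<^bsub>H\<^esub> inv\<^bsub>H\<^esub> x \<otimes>\<^bsub>H\<^esub> inv\<^bsub>H\<^esub> y})"
          by blast
    qed
    then have "generate H (h ` ?C) \<subseteq> lower_central H (Suc n)"
      unfolding lower_central.simps by (rule H.mono_generate)
    finally show ?case .
  qed auto
  obtain n where n: "lower_central H n = {\<one>\<^bsub>H\<^esub>}" using assms(1) by (auto simp: nilpotent_group_def)
  have "(\<Union>x \<in> lower_central G n. \<Union>y \<in> carrier G. {x \<otimes> y \<otimes> inv x \<otimes> inv y}) \<subseteq> {\<one>}"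
  proof clarsimp
    fix x y assume x: "x \<in> lower_central G n" and y: "y \<in> carrier G"
    then have xG: "x \<in> carrier G"
      using subgroup.mem_carrier[OF G.subgroup_lower_central] by blast
    have "h x = \<one>\<^bsub>H\<^esub>" using img[of n] n x by auto
    then have "x \<otimes> y = y \<otimes> x" by (rule assms(2)[OF xG y])
    then show "x \<otimes> y \<otimes> inv x \<otimes> inv y = \<one>"
      using xG y by (simp add: G.m_assoc)
  qed
  then have "lower_central G (Suc n) \<subseteq> {\<one>}"
    unfolding lower_central.simps by (rule G.generate_subgroup_incl[OF _ G.triv_subgroup])
  then have "lower_central G (Suc n) = {\<one>}"
    using subgroup.one_closed[OF G.subgroup_lower_central, of "Suc n"] by blast
  then show ?thesis using G.is_group unfolding nilpotent_group_def by blast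
qed

section \<open>Copies and quotients of finite groups over \<open>nat\<close>\<close>

lemma (in group) nat_copy:
  assumes "finite (carrier G)"
  shows "\<exists>(K :: nat monoid) \<phi>. group K \<and> \<phi> \<in> hom G K \<and> \<phi> ` carrier G = carrier K \<and> inj_on \<phi> (carrier G)"
proof -
  obtain \<phi> :: "'a \<Rightarrow> nat" where \<phi>: "inj_on \<phi> (carrier G)"
    using finite_imp_inj_to_nat_seg[OF assms] by blast
  define \<psi> where "\<psi> = inv_into (carrier G) \<phi>"
  have \<psi>: "\<psi> (\<phi> x) = x" if "x \<in> carrier G" for x using \<phi> that by (simp add: \<psi>_def)
  define K where "K = \<lparr>carrier = \<phi> ` carrier G, monoid.mult = (\<lambda>x y. \<phi> (\<psi> x \<otimes> \<psi> y)), one = \<phi> \<one>\<rparr>"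
  have "group K"
  proof (rule groupI)
    fix x assume "x \<in> carrier K"
    then obtain x' where "x = \<phi> x'" "x' \<in> carrier G" by (auto simp: K_def)
    then show "\<exists>y\<in>carrier K. y \<otimes>\<^bsub>K\<^esub> x = \<one>\<^bsub>K\<^esub>"
      by (intro bexI[of _ "\<phi> (inv x')"]) (auto simp: K_def \<psi>)
  qed (auto simp: K_def \<psi> m_assoc)
  moreover have "\<phi> \<in> hom G K" by (auto simp: hom_def K_def \<psi>)
  ultimately show ?thesis using \<phi> by (intro exI[of _ K] exI[of _ \<phi>]) (auto simp: K_def)
qed

lemma (in group) nat_quotient:
  assumes "finite (carrier G)" "N \<lhd> G"
  shows "\<exists>(K :: nat monoid) \<phi>. group_hom G K \<phi> \<and> \<phi> ` carrier G = carrier K \<and>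
    (\<forall>x \<in> carrier G. \<phi> x = \<one>\<^bsub>K\<^esub> \<longrightarrow> x \<in> N) \<and> order K * card N = order G"
proof -
  interpret N: normal N G by fact
  have fin: "finite (carrier (G Mod N))"
    using assms(1) by (auto simp: FactGroup_def RCOSETS_def)
  obtain K :: "nat monoid" and \<phi> where K: "group K" "\<phi> \<in> hom (G Mod N) K"
    "\<phi> ` carrier (G Mod N) = carrier K" "inj_on \<phi> (carrier (G Mod N))"
    using group.nat_copy[OF N.factorgroup_is_group fin] by blast
  let ?c = "\<lambda>x. N #> x"
  have c: "?c \<in> hom G (G Mod N)" "?c ` carrier G = carrier (G Mod N)"
    using N.r_coset_hom_Mod by (auto simp: FactGroup_def RCOSETS_def)
  have hom: "group_hom G K (\<phi> \<circ> ?c)"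
  proof -
    have "\<phi> \<circ> ?c \<in> hom G K"
      using hom_in_carrier[OF c(1)] hom_mult[OF c(1)] hom_in_carrier[OF K(2)] hom_mult[OF K(2)]
      by (intro homI) simp_all
    then show ?thesis using K(1) is_group by (simp add: group_hom_def group_hom_axioms_def)
  qed
  have "x \<in> N" if x: "x \<in> carrier G" "\<phi> (?c x) = \<one>\<^bsub>K\<^esub>" for x
  proof -
    have "\<phi> \<one>\<^bsub>G Mod N\<^esub> = \<one>\<^bsub>K\<^esub>"
      using hom_one[OF K(2) N.factorgroup_is_group K(1)] .
    moreover have "?c x \<in> carrier (G Mod N)" using x(1) c(2) by blast
    moreover have "\<one>\<^bsub>G Mod N\<^esub> \<in> carrier (G Mod N)"
      by (rule monoid.one_closed[OF group.is_monoid[OF N.factorgroup_is_group]])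
    ultimately have "?c x = \<one>\<^bsub>G Mod N\<^esub>" using x(2) inj_onD[OF K(4)] by simp
    then have "N #> x = N" by (simp add: FactGroup_def)
    then show ?thesis using rcos_self[OF x(1) N.is_subgroup] by simp
  qed
  moreover have "card (carrier (G Mod N)) * card N = order G"
    using lagrange[OF N.is_subgroup] by (simp add: FactGroup_def)
  then have "order K * card N = order G" using card_image[OF K(4)] K(3) by (simp add: order_def)
  moreover have "(\<phi> \<circ> ?c) ` carrier G = carrier K"
    using c(2) K(3) by (simp only: image_comp[symmetric])
  ultimately show ?thesis using hom by (intro exI[of _ K] exI[of _ "\<phi> \<circ> ?c"]) simp
qed

subsection \<open>Conjugates of maximal subgroups\<close>

context group
begin

definition conj_set :: "'a \<Rightarrow> 'a set \<Rightarrow> 'a set" where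
  "conj_set x A = (\<lambda>h. x \<otimes> h \<otimes> inv x) ` A"

definition maximal_subgroup :: "'a set \<Rightarrow> bool" where
  "maximal_subgroup M \<longleftrightarrow> subgroup M G \<and> M \<noteq> carrier G \<and>
     (\<forall>H. subgroup H G \<longrightarrow> M \<subseteq> H \<longrightarrow> H = M \<or> H = carrier G)"

lemma maximal_subgroupD:
  assumes "maximal_subgroup M" "M \<subseteq> H" "subgroup H G" "H \<noteq> carrier G"
  shows "H = M"
  using assms unfolding maximal_subgroup_def by blast

lemma conj_set_mult:
  assumes "x \<in> carrier G" "y \<in> carrier G" "A \<subseteq> carrier G"
  shows "conj_set x (conj_set y A) = conj_set (x \<otimes> y) A"
  unfolding conj_set_def image_image
  by (intro image_cong refl) (use assms in \<open>auto simp: m_assoc inv_mult_group\<close>)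

lemma conj_set_one: "A \<subseteq> carrier G \<Longrightarrow> conj_set \<one> A = A"
  unfolding conj_set_def by (auto simp: subset_iff image_iff)

lemma conj_set_subset: "x \<in> carrier G \<Longrightarrow> A \<subseteq> carrier G \<Longrightarrow> conj_set x A \<subseteq> carrier G"
  by (auto simp: conj_set_def)

lemma card_conj_set: "x \<in> carrier G \<Longrightarrow> A \<subseteq> carrier G \<Longrightarrow> card (conj_set x A) = card A"
  unfolding conj_set_def by (intro card_image inj_onI) (auto simp: subset_iff)

lemma subgroup_conj_set:
  assumes "x \<in> carrier G" "subgroup H G"
  shows "subgroup (conj_set x H) G"
proof -
  interpret H: subgroup H G by fact
  show ?thesis
  proof (rule subgroupI)
    fix a assume "a \<in> conj_set x H"
    then obtain h where h: "h \<in> H" "a = x \<otimes> h \<otimes> inv x"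
      by (auto simp: conj_set_def)
    then have "inv a = x \<otimes> inv h \<otimes> inv x"
      using assms(1) by (simp add: inv_mult_group m_assoc)
    then show "inv a \<in> conj_set x H" using h by (auto simp: conj_set_def)
  next
    fix a b assume "a \<in> conj_set x H" "b \<in> conj_set x H"
    then obtain h k where h: "h \<in> H" "a = x \<otimes> h \<otimes> inv x" "k \<in> H" "b = x \<otimes> k \<otimes> inv x"
      by (auto simp: conj_set_def)
    then have "a \<otimes> b = x \<otimes> (h \<otimes> k) \<otimes> inv x"
      using assms(1) by (simp add: m_assoc)
    then show "a \<otimes> b \<in> conj_set x H" using h by (auto simp: conj_set_def)
  next
    show "conj_set x H \<subseteq> carrier G" by (rule conj_set_subset[OF assms(1) H.subset])
    have "x \<otimes> \<one> \<otimes> inv x \<in> conj_set x H" unfolding conj_set_def using H.one_closed by (rule imageI)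
    then show "conj_set x H \<noteq> {}" by blast
  qed
qed

lemma conj_set_inv:
  assumes "x \<in> carrier G" "A \<subseteq> carrier G"
  shows "conj_set (inv x) (conj_set x A) = A" "conj_set x (conj_set (inv x) A) = A"
  using assms by (simp_all add: conj_set_mult conj_set_one)

lemma subgroup_conj_stabilizer:
  assumes "A \<subseteq> carrier G"
  shows "subgroup {x \<in> carrier G. conj_set x A = A} G"
proof (rule subgroupI)
  fix a assume "a \<in> {x \<in> carrier G. conj_set x A = A}"
  then show "inv a \<in> {x \<in> carrier G. conj_set x A = A}"
    using conj_set_inv(1)[OF _ assms, of a] by simp
next
  fix a b assume "a \<in> {x \<in> carrier G. conj_set x A = A}" "b \<in> {x \<in> carrier G. conj_set x A = A}"
  then show "a \<otimes> b \<in> {x \<in> carrier G. conj_set x A = A}"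
    using conj_set_mult[OF _ _ assms, of a b] by simp
qed (use assms conj_set_one in auto)

lemma conj_set_subgroup_self:
  assumes "subgroup H G" "x \<in> H" "finite H"
  shows "conj_set x H = H"
proof (rule card_subset_eq)
  interpret H: subgroup H G by fact
  show "conj_set x H \<subseteq> H" using assms(2) by (auto simp: conj_set_def)
  show "card (conj_set x H) = card H" using assms(2) H.subset by (intro card_conj_set) auto
qed fact

lemma subgroup_centralizer:
  assumes "V \<subseteq> carrier G"
  shows "subgroup {x \<in> carrier G. \<forall>v \<in> V. x \<otimes> v = v \<otimes> x} G"
proof (rule subgroupI)
  fix a assume a: "a \<in> {x \<in> carrier G. \<forall>v \<in> V. x \<otimes> v = v \<otimes> x}"
  have "inv a \<otimes> v = v \<otimes> inv a" if v: "v \<in> V" for v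
  proof -
    have vG: "v \<in> carrier G" using v assms by blast
    have "inv a \<otimes> v = inv a \<otimes> (v \<otimes> a) \<otimes> inv a"
      using a vG by (simp add: m_assoc)
    also have "v \<otimes> a = a \<otimes> v" using a v by simp
    also have "inv a \<otimes> (a \<otimes> v) \<otimes> inv a = v \<otimes> inv a"
      using a vG by simp
    finally show ?thesis .
  qed
  then show "inv a \<in> {x \<in> carrier G. \<forall>v \<in> V. x \<otimes> v = v \<otimes> x}"
    using a by simp
next
  fix a b
  assume ab: "a \<in> {x \<in> carrier G. \<forall>v \<in> V. x \<otimes> v = v \<otimes> x}" "b \<in> {x \<in> carrier G. \<forall>v \<in> V. x \<otimes> v = v \<otimes> x}"
  have "a \<otimes> b \<otimes> v = v \<otimes> (a \<otimes> b)" if v: "v \<in> V" for v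
  proof -
    have vG: "v \<in> carrier G" using v assms by blast
    have "a \<otimes> b \<otimes> v = a \<otimes> (v \<otimes> b)"
      using ab v vG by (simp add: m_assoc)
    also have "\<dots> = v \<otimes> a \<otimes> b" using ab v vG by (simp flip: m_assoc)
    finally show ?thesis using ab vG by (simp add: m_assoc)
  qed
  then show "a \<otimes> b \<in> {x \<in> carrier G. \<forall>v \<in> V. x \<otimes> v = v \<otimes> x}"
    using ab by simp
next
  have "\<one> \<in> {x \<in> carrier G. \<forall>v \<in> V. x \<otimes> v = v \<otimes> x}"
    using assms by (auto simp: subset_iff)
  then show "{x \<in> carrier G. \<forall>v \<in> V. x \<otimes> v = v \<otimes> x} \<noteq> {}"
    by blast
qed auto

lemma maximal_subgroup_conj_set:
  assumes "maximal_subgroup M" "g \<in> carrier G"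
  shows "maximal_subgroup (conj_set g M)"
  unfolding maximal_subgroup_def
proof (intro conjI allI impI)
  have M: "subgroup M G" "M \<noteq> carrier G" using assms(1) by (auto simp: maximal_subgroup_def)
  have MG: "M \<subseteq> carrier G" by (rule subgroup.subset[OF M(1)])
  show "subgroup (conj_set g M) G" by (rule subgroup_conj_set[OF assms(2) M(1)])
  have full: "conj_set x (carrier G) = carrier G" if x: "x \<in> carrier G" for x
  proof
    show "conj_set x (carrier G) \<subseteq> carrier G" using x by (intro conj_set_subset) auto
    have "conj_set x (conj_set (inv x) (carrier G)) \<subseteq> conj_set x (carrier G)"
      unfolding conj_set_def[of x] using x by (intro image_mono conj_set_subset) auto
    then show "carrier G \<subseteq> conj_set x (carrier G)" using x by (simp add: conj_set_inv)
  qed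
  show "conj_set g M \<noteq> carrier G"
  proof
    assume "conj_set g M = carrier G"
    then have "M = conj_set (inv g) (carrier G)" using conj_set_inv(1)[OF assms(2) MG] by simp
    then show False using full[of "inv g"] M(2) assms(2) by simp
  qed
  fix H assume H: "subgroup H G" "conj_set g M \<subseteq> H"
  have HG: "H \<subseteq> carrier G" by (rule subgroup.subset[OF H(1)])
  have "conj_set (inv g) (conj_set g M) \<subseteq> conj_set (inv g) H"
    unfolding conj_set_def[of "inv g"] using H(2) by (rule image_mono)
  then have "M \<subseteq> conj_set (inv g) H" using conj_set_inv(1)[OF assms(2) MG] by simp
  then have "conj_set (inv g) H = M \<or> conj_set (inv g) H = carrier G"
    using assms H(1) subgroup_conj_set[of "inv g" H] by (auto simp: maximal_subgroup_def)
  then have "conj_set g (conj_set (inv g) H) = conj_set g M \<or>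
      conj_set g (conj_set (inv g) H) = conj_set g (carrier G)" by auto
  then show "H = conj_set g M \<or> H = carrier G"
    using conj_set_inv(2)[OF assms(2) HG] full[OF assms(2)] by simp
qed

lemma subgroup_le_maximal_subgroup:
  assumes "finite (carrier G)" "subgroup H G" "H \<noteq> carrier G"
  shows "\<exists>M. maximal_subgroup M \<and> H \<subseteq> M"
proof -
  let ?A = "{K. subgroup K G \<and> K \<noteq> carrier G}"
  have "?A \<subseteq> Pow (carrier G)" by (auto dest: subgroup.mem_carrier)
  then have "finite ?A" using assms(1) by (meson finite_Pow_iff finite_subset)
  moreover have "H \<in> ?A" using assms by simp
  ultimately obtain M where M: "M \<in> ?A" "H \<subseteq> M" "\<forall>K\<in>?A. M \<subseteq> K \<longrightarrow> M = K"
    using finite_has_maximal2[of ?A H] by auto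
  then show ?thesis unfolding maximal_subgroup_def by (intro exI[of _ M]) auto
qed

text \<open>Each conjugate of a nontrivial element of \<open>M\<close> arises from exactly \<open>card M\<close> pairs
  \<open>(g, m)\<close>.\<close>

lemma card_conjugates_of_TI_subgroup:
  assumes fin: "finite (carrier G)" and M: "subgroup M G"
    and TI: "\<And>k u. k \<in> carrier G \<Longrightarrow> u \<in> M \<Longrightarrow> u \<noteq> \<one> \<Longrightarrow> u \<in> conj_set k M \<Longrightarrow> k \<in> M"
  shows "card (\<Union>g\<in>carrier G. conj_set g (M - {\<one>})) * card M = order G * (card M - 1)"
proof -
  interpret M: subgroup M G by fact
  define U where "U = (\<Union>g\<in>carrier G. conj_set g (M - {\<one>}))"
  have "\<forall>u\<in>U. \<exists>c. c \<in> carrier G \<and> u \<in> conj_set c (M - {\<one>})"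
    by (auto simp: U_def)
  \<comment> \<open>\<open>c\<close> chooses one conjugating element for each
    \<open>u\<close>.\<close>
  then obtain c where c: "\<And>u. u \<in> U \<Longrightarrow> c u \<in> carrier G" "\<And>u. u \<in> U \<Longrightarrow> u \<in> conj_set (c u) (M - {\<one>})"
    by metis
  have UG: "u \<in> carrier G" if "u \<in> U" for u using that by (auto simp: U_def conj_set_def)
  \<comment> \<open>By \<open>TI\<close>, the elements whose conjugation carries a member of
    \<open>M\<close> to \<open>u\<close> form the coset of \<open>c u\<close> by \<open>M\<close>.
    So \<open>(u, k)\<close> corresponds to \<open>g = c u \<otimes> k\<close> together with the
    preimage of \<open>u\<close> under conjugation by \<open>g\<close>.\<close>
  define f where "f = (\<lambda>(u, k). (c u \<otimes> k, inv (c u \<otimes> k) \<otimes> u \<otimes> (c u \<otimes> k)))"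
  have "bij_betw f (U \<times> M) (carrier G \<times> (M - {\<one>}))"
    unfolding bij_betw_def
  proof
    show "inj_on f (U \<times> M)"
    proof (rule inj_onI, clarify)
      fix u k u' k' assume *: "u \<in> U" "k \<in> M" "u' \<in> U" "k' \<in> M" "f (u, k) = f (u', k')"
      then have g: "c u \<otimes> k = c u' \<otimes> k'" by (simp add: f_def)
      define g where "g = c u \<otimes> k"
      have gG: "g \<in> carrier G" using * c by (simp add: g_def)
      have "inv g \<otimes> u \<otimes> g = inv g \<otimes> u' \<otimes> g"
        using * g by (simp add: f_def g_def)
      then have "u = u'" using gG UG * by simp
      moreover from this have "k = k'" using g * c by simp
      ultimately show "u = u' \<and> k = k'" by simp
    qed
    show "f ` (U \<times> M) = carrier G \<times> (M - {\<one>})"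
    proof
      show "f ` (U \<times> M) \<subseteq> carrier G \<times> (M - {\<one>})"
      proof
        fix y assume "y \<in> f ` (U \<times> M)"
        then obtain u k where "y = f (u, k)" "u \<in> U" "k \<in> M" by auto
        moreover obtain g m where y: "y = (g, m)" by fastforce
        ultimately have *: "(g, m) = f (u, k)" "u \<in> U" "k \<in> M" by simp_all
        obtain n where n: "n \<in> M" "n \<noteq> \<one>" "u = c u \<otimes> n \<otimes> inv (c u)"
          using c(2)[OF *(2)] by (auto simp: conj_set_def)
        have cu: "c u \<in> carrier G" using c *(2) by blast
        have "inv (c u \<otimes> k) \<otimes> (c u \<otimes> n \<otimes> inv (c u)) \<otimes> (c u \<otimes> k) = inv k \<otimes> n \<otimes> k"
          using cu * n(1) by (simp add: m_assoc inv_mult_group)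
        then have m: "m = inv k \<otimes> n \<otimes> k" using * n(3) by (simp add: f_def)
        have "k \<otimes> m \<otimes> inv k = n" using m * n by (simp add: m_assoc)
        then have "m \<noteq> \<one>" using n * by auto
        moreover have "m \<in> M" using m * n by simp
        moreover have "g \<in> carrier G" using * cu by (simp add: f_def)
        ultimately show "y \<in> carrier G \<times> (M - {\<one>})" by (simp add: y)
      qed
      show "carrier G \<times> (M - {\<one>}) \<subseteq> f ` (U \<times> M)"
      proof
        fix y assume "y \<in> carrier G \<times> (M - {\<one>})"
        then obtain g m where *: "g \<in> carrier G" "m \<in> M" "m \<noteq> \<one>" and y: "y = (g, m)"
          by auto
        define u where "u = g \<otimes> m \<otimes> inv g"
        have u: "u \<in> U" using * by (auto simp: U_def conj_set_def u_def)
        obtain n where n: "n \<in> M" "u = c u \<otimes> n \<otimes> inv (c u)"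
          using c(2)[OF u] by (auto simp: conj_set_def)
        have cu: "c u \<in> carrier G" using c u by blast
        have "m = inv g \<otimes> u \<otimes> g" using * by (simp add: u_def m_assoc)
        also have "\<dots> = inv g \<otimes> (c u \<otimes> n \<otimes> inv (c u)) \<otimes> g"
          using n(2) by simp
        also have "\<dots> = (inv g \<otimes> c u) \<otimes> n \<otimes> inv (inv g \<otimes> c u)"
          using * n(1) cu by (simp add: m_assoc inv_mult_group)
        finally have "m \<in> conj_set (inv g \<otimes> c u) M"
          using n(1) by (auto simp: conj_set_def)
        \<comment> \<open>The nontrivial element \<open>m\<close> lies both in \<open>M\<close> and
          in this conjugate of \<open>M\<close>.\<close>
        then have "inv g \<otimes> c u \<in> M" using TI[of "inv g \<otimes> c u" m] * cu by simp
        then have "inv (inv g \<otimes> c u) \<in> M" by simp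
        then have k: "inv (c u) \<otimes> g \<in> M" using * cu by (simp add: inv_mult_group)
        have g: "c u \<otimes> (inv (c u) \<otimes> g) = g" using * cu by simp
        have "f (u, inv (c u) \<otimes> g) = (g, inv g \<otimes> u \<otimes> g)"
          by (simp only: f_def split g)
        also have "inv g \<otimes> u \<otimes> g = m" using * by (simp add: u_def m_assoc)
        finally have "y = f (u, inv (c u) \<otimes> g)" by (simp add: y)
        then show "y \<in> f ` (U \<times> M)" using u k by blast
      qed
    qed
  qed
  then have "card (U \<times> M) = card (carrier G \<times> (M - {\<one>}))"
    by (rule bij_betw_same_card)
  then show ?thesis by (simp add: card_cartesian_product U_def order_def)
qed

end

subsection \<open>Minimal nonnilpotent groups\<close>

text \<open>Trivial center and \<open>nontrivial\<close> together exclude nilpotency of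
  \<open>G\<close> itself, by \<open>nilpotent_center_nontrivial\<close>. Triviality of the center
  can be arranged because nontrivial centers are factored out in the final induction.\<close>

locale minimal_nonnilpotent = group +
  assumes fin: "finite (carrier G)"
    and proper: "\<And>H. subgroup H G \<Longrightarrow> H \<noteq> carrier G \<Longrightarrow> nilpotent_group (G\<lparr>carrier := H\<rparr>)"
    and center: "\<And>z. z \<in> carrier G \<Longrightarrow> \<forall>y \<in> carrier G. z \<otimes> y = y \<otimes> z \<Longrightarrow> z = \<one>"
    and nontrivial: "carrier G \<noteq> {\<one>}"
begin

lemma proper_subgroup_normalizer_grows:
  assumes "subgroup M G" "M \<noteq> carrier G" "subgroup I G" "I \<subset> M"
  shows "\<exists>x \<in> M - I. conj_set x I = I"
proof -
  let ?M = "G\<lparr>carrier := M\<rparr>"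
  have "group ?M" by (rule subgroup_imp_group[OF assms(1)])
  moreover have "subgroup I ?M" using assms by (intro subgroup_incl) auto
  ultimately obtain x where x: "x \<in> M - I" "\<forall>h \<in> I. x \<otimes> h \<otimes> inv\<^bsub>?M\<^esub> x \<in> I"
    using group.nilpotent_normalizer_grows[of ?M I] proper[OF assms(1,2)] assms(4) by auto
  then have sub: "conj_set x I \<subseteq> I"
    using m_inv_consistent[OF assms(1), of x] by (auto simp: conj_set_def)
  have I: "I \<subseteq> carrier G" by (rule subgroup.subset[OF assms(3)])
  have xG: "x \<in> carrier G" using x(1) subgroup.mem_carrier[OF assms(1)] by blast
  have "conj_set x I = I"
    using sub finite_subset[OF I fin] card_conj_set[OF xG I] by (intro card_subset_eq)
  with x show ?thesis by blast
qed

section \<open>Exclusion of the simple case by counting\<close>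

context
  assumes simple: "\<And>N. N \<lhd> G \<Longrightarrow> N = {\<one>} \<or> N = carrier G"
begin

lemma proper_conj_stabilizer:
  assumes "subgroup I G" "I \<noteq> {\<one>}" "I \<noteq> carrier G"
  shows "{x \<in> carrier G. conj_set x I = I} \<noteq> carrier G"
proof
  assume *: "{x \<in> carrier G. conj_set x I = I} = carrier G"
  have "x \<otimes> h \<otimes> inv x \<in> I" if "x \<in> carrier G" "h \<in> I" for x h
  proof -
    have "conj_set x I = I" using * that(1) by blast
    then show ?thesis using that(2) unfolding conj_set_def by blast
  qed
  then have "I \<lhd> G" using assms(1) by (simp add: normal_inv_iff)
  with simple assms show False by blast
qed

text \<open>For distinct maximal subgroups with nontrivial intersection \<open>I\<close>, a maximal subgroup above the
  normalizer of \<open>I\<close> meets one of them in a larger subgroup, because normalizers grow in nilpotent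
  groups.\<close>

lemma maximal_subgroups_inter_trivial:
  assumes "maximal_subgroup M1" "maximal_subgroup M2" "M1 \<noteq> M2"
  shows "M1 \<inter> M2 = {\<one>}"
  using assms
proof (induction "order G - card (M1 \<inter> M2)" arbitrary: M1 M2 rule: less_induct)
  case less
  define I where "I = M1 \<inter> M2"
  define N where "N = {x \<in> carrier G. conj_set x I = I}"
  have M: "subgroup M1 G" "M1 \<noteq> carrier G" "subgroup M2 G" "M2 \<noteq> carrier G"
    using less.prems by (auto simp: maximal_subgroup_def)
  have MG: "M1 \<subseteq> carrier G" "M2 \<subseteq> carrier G"
    by (rule subgroup.subset[OF M(1)], rule subgroup.subset[OF M(3)])
  have I: "subgroup I G" unfolding I_def by (rule subgroups_Inter_pair[OF M(1,3)])
  have IG: "I \<subseteq> carrier G" using MG by (auto simp: I_def)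
  have "\<not> M1 \<subseteq> M2" using less.prems(1,3) M(3,4) by (auto simp: maximal_subgroup_def)
  moreover have "\<not> M2 \<subseteq> M1"
    using less.prems(2,3) M(1,2) by (auto simp: maximal_subgroup_def)
  ultimately have ss: "I \<subset> M1" "I \<subset> M2" by (auto simp: I_def)
  have "I = {\<one>}"
  proof (rule ccontr)
    assume ne: "I \<noteq> {\<one>}"
    have "I \<noteq> carrier G" using M(2) MG(1) ss(1) by auto
    then have "N \<noteq> carrier G" unfolding N_def by (rule proper_conj_stabilizer[OF I ne])
    moreover have "subgroup N G" unfolding N_def by (rule subgroup_conj_stabilizer[OF IG])
    ultimately obtain M3 where M3: "maximal_subgroup M3" "N \<subseteq> M3"
      using subgroup_le_maximal_subgroup[OF fin, of N] by auto
    have IN: "x \<in> N" if "x \<in> I" for x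
      using conj_set_subgroup_self[OF I that finite_subset[OF IG fin]] that IG by (auto simp: N_def)
    \<comment> \<open>A subgroup \<open>K\<close> that properly contains \<open>I\<close> has an
      element normalizing \<open>I\<close> outside \<open>I\<close>, which also lies in
      \<open>M3\<close>. If \<open>M3\<close> differed from \<open>K\<close>, their intersection
      would be larger than \<open>I\<close>, hence trivial by induction, against \<open>ne\<close>.
      Taking \<open>M1\<close> and \<open>M2\<close> for \<open>K\<close> forces them to
      coincide.\<close>
    have M3_eq: "M3 = K" if K: "maximal_subgroup K" "I \<subset> K" for K
    proof (rule ccontr)
      assume neq: "M3 \<noteq> K"
      have KG: "subgroup K G" "K \<noteq> carrier G" using K(1) by (auto simp: maximal_subgroup_def)
      obtain x where x: "x \<in> K" "x \<notin> I" "conj_set x I = I"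
        using proper_subgroup_normalizer_grows[OF KG I K(2)] by auto
      then have "x \<in> N" using subgroup.mem_carrier[OF KG(1)] by (simp add: N_def)
      then have "x \<in> M3 \<inter> K" using x(1) M3(2) by auto
      moreover have sub: "I \<subseteq> M3 \<inter> K" using IN M3(2) K(2) by auto
      ultimately have ps: "I \<subset> M3 \<inter> K" using x(2) by auto
      have fK: "M3 \<inter> K \<subseteq> carrier G" using subgroup.subset[OF KG(1)] by auto
      have "card I < card (M3 \<inter> K)"
        by (rule psubset_card_mono[OF finite_subset[OF fK fin] ps])
      moreover have "card (M3 \<inter> K) \<le> order G" unfolding order_def by (rule card_mono[OF fin fK])
      ultimately have "order G - card (M3 \<inter> K) < order G - card (M1 \<inter> M2)"
        unfolding I_def by simp
      from less.hyps[OF this M3(1) K(1) neq] have "I \<subseteq> {\<one>}" using sub by simp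
      with subgroup.one_closed[OF I] ne show False by auto
    qed
    have "M3 = M1" "M3 = M2"
      by (rule M3_eq[OF less.prems(1) ss(1)], rule M3_eq[OF less.prems(2) ss(2)])
    with less.prems(3) show False by simp
  qed
  then show ?case by (simp add: I_def)
qed

text \<open>If \<open>{\<one>}\<close> were maximal, the centralizer of any \<open>y\<close> other
  than \<open>\<one>\<close> would be all of \<open>G\<close>, since it contains \<open>y\<close>.
  Then \<open>G\<close> would be abelian, contrary to its trivial center.\<close>

lemma maximal_subgroup_nontrivial:
  assumes "maximal_subgroup M"
  shows "M \<noteq> {\<one>}"
proof
  assume M: "M = {\<one>}"
  obtain x where x: "x \<in> carrier G" "x \<noteq> \<one>" using nontrivial by auto
  have "y \<otimes> x = x \<otimes> y" if y: "y \<in> carrier G" for y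
  proof (cases "y = \<one>")
    case False
    let ?C = "{z \<in> carrier G. \<forall>v \<in> {y}. z \<otimes> v = v \<otimes> z}"
    have "subgroup ?C G" using y by (intro subgroup_centralizer) auto
    moreover have "M \<subseteq> ?C" using y by (simp add: M)
    ultimately have "?C = M \<or> ?C = carrier G" using assms by (simp add: maximal_subgroup_def)
    moreover have "y \<in> ?C" using y by simp
    ultimately have "?C = carrier G" using False M by auto
    then have "x \<in> ?C" using x(1) by simp
    then show ?thesis by simp
  qed (use x in simp)
  then have "\<forall>y \<in> carrier G. x \<otimes> y = y \<otimes> x" by simp
  from center[OF x(1) this] x(2) show False by simp
qed

text \<open>Distinct maximal subgroups meet trivially, so sharing \<open>u\<close> makes the
  conjugate equal to \<open>M\<close>. Hence \<open>k\<close> normalizes \<open>M\<close>, and in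
  the absence of proper normal subgroups a maximal subgroup is its own normalizer.\<close>

lemma maximal_subgroup_TI:
  assumes M: "maximal_subgroup M" and k: "k \<in> carrier G" and u: "u \<in> M" "u \<noteq> \<one>" "u \<in> conj_set k M"
  shows "k \<in> M"
proof -
  have MG: "subgroup M G" "M \<noteq> carrier G" using M by (auto simp: maximal_subgroup_def)
  have "conj_set k M = M"
  proof (rule ccontr)
    assume "conj_set k M \<noteq> M"
    then have "conj_set k M \<inter> M = {\<one>}"
      by (rule maximal_subgroups_inter_trivial[OF maximal_subgroup_conj_set[OF M k] M])
    with u show False by blast
  qed
  let ?N = "{x \<in> carrier G. conj_set x M = M}"
  have "finite M" using subgroup.subset[OF MG(1)] fin by (rule finite_subset)
  then have "M \<subseteq> ?N"
    using conj_set_subgroup_self[OF MG(1)] subgroup.mem_carrier[OF MG(1)] by (intro subsetI) simp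
  moreover have "subgroup ?N G" using subgroup.subset[OF MG(1)] by (rule subgroup_conj_stabilizer)
  moreover have "?N \<noteq> carrier G"
    by (rule proper_conj_stabilizer[OF MG(1) maximal_subgroup_nontrivial[OF M] MG(2)])
  ultimately have "?N = M" by (rule maximal_subgroupD[OF M])
  with \<open>conj_set k M = M\<close> k show ?thesis by blast
qed

text \<open>The nontrivial elements in the conjugates of a maximal subgroup make up at least half of the
  group but not all of its nontrivial elements, so two classes of maximal subgroups are too many.\<close>

lemma simple_impossible: False
proof -
  define U where "U = (\<lambda>M. \<Union>g\<in>carrier G. conj_set g (M - {\<one>}))"
  have cardU: "card (U M) * card M = order G * (card M - 1)" "2 \<le> card M" if "maximal_subgroup M" for M
  proof -
    have M: "subgroup M G" "M \<noteq> {\<one>}"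
      using that maximal_subgroup_nontrivial by (auto simp: maximal_subgroup_def)
    show "card (U M) * card M = order G * (card M - 1)"
      unfolding U_def by (rule card_conjugates_of_TI_subgroup[OF fin M(1) maximal_subgroup_TI[OF that]])
    have fM: "finite M" using subgroup.subset[OF M(1)] fin by (rule finite_subset)
    have "{\<one>} \<subset> M" using M subgroup.one_closed[OF M(1)] by blast
    from psubset_card_mono[OF fM this] show "2 \<le> card M" by simp
  qed
  have U_sub: "U M \<subseteq> carrier G - {\<one>}" if "maximal_subgroup M" for M
  proof
    fix u assume "u \<in> U M"
    then obtain g m where gm: "g \<in> carrier G" "m \<in> M" "m \<noteq> \<one>" "u = g \<otimes> m \<otimes> inv g"
      by (auto simp: U_def conj_set_def)
    have m: "m \<in> carrier G"
      using that gm(2) by (auto simp: maximal_subgroup_def dest: subgroup.mem_carrier)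
    have "inv g \<otimes> u \<otimes> g = m" using gm m by (simp add: m_assoc)
    then have "u \<noteq> \<one>" using gm by auto
    then show "u \<in> carrier G - {\<one>}" using gm m by simp
  qed
  have order_pos: "order G > 0" using fin by (simp add: order_gt_0_iff_finite)
  \<comment> \<open>The class of \<open>M\<close> covers the fraction \<open>1 - 1 / card M\<close>
    of the order, and \<open>card M\<close> is at least \<open>2\<close>.\<close>
  have half: "order G \<le> 2 * card (U M)" if M: "maximal_subgroup M" for M
  proof -
    obtain c where c: "card M = c + 2" using le_Suc_ex[OF cardU(2)[OF M]] by auto
    have "order G * (c + 2) \<le> 2 * (order G * (c + 1))" by simp
    also have "order G * (c + 1) = card (U M) * (c + 2)" using cardU(1)[OF M] c by simp
    finally have "order G * (c + 2) \<le> (2 * card (U M)) * (c + 2)" by simp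
    then show ?thesis by (rule mult_right_le_imp_le) simp
  qed
  have "subgroup {\<one>} G" by (rule triv_subgroup)
  then obtain M where M: "maximal_subgroup M"
    using subgroup_le_maximal_subgroup[OF fin _ nontrivial[symmetric]] by auto
  \<comment> \<open>Equality would give
    \<open>(order G - 1) * card M = order G * (card M - 1)\<close>, hence
    \<open>card M = order G\<close>.\<close>
  have "U M \<noteq> carrier G - {\<one>}"
  proof
    assume "U M = carrier G - {\<one>}"
    then have "card (U M) = order G - 1" using fin by (simp add: order_def)
    then have eq: "(order G - 1) * card M = order G * (card M - 1)" using cardU(1)[OF M] by simp
    have "order G * card M - card M = order G * card M - order G"
      using eq by (simp add: diff_mult_distrib diff_mult_distrib2)
    moreover have "order G * 1 \<le> order G * card M" "1 * card M \<le> order G * card M"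
      using order_pos cardU(2)[OF M] by (intro mult_le_mono; simp)+
    ultimately have "card M = order G" by linarith
    moreover have "M \<subset> carrier G"
      using M by (auto simp: maximal_subgroup_def dest: subgroup.subset)
    then have "card M < order G" unfolding order_def by (rule psubset_card_mono[OF fin])
    ultimately show False by simp
  qed
  then obtain x where x: "x \<in> carrier G" "x \<noteq> \<one>" "x \<notin> U M" using U_sub[OF M] by blast
  \<comment> \<open>The centralizer of \<open>x\<close> is proper and contains \<open>x\<close>; it
    supplies a maximal subgroup through a point that the class of \<open>M\<close> misses.\<close>
  let ?C = "{z \<in> carrier G. \<forall>v \<in> {x}. z \<otimes> v = v \<otimes> z}"
  have "subgroup ?C G" using x by (intro subgroup_centralizer) auto
  moreover have "?C \<noteq> carrier G"
  proof
    assume "?C = carrier G"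
    then have "y \<in> ?C" if "y \<in> carrier G" for y using that by simp
    then have "\<forall>y\<in>carrier G. x \<otimes> y = y \<otimes> x" by simp
    from center[OF x(1) this] x(2) show False by simp
  qed
  ultimately obtain M' where M': "maximal_subgroup M'" "?C \<subseteq> M'"
    using subgroup_le_maximal_subgroup[OF fin, of ?C] by auto
  have xM': "x \<in> M'" using x(1) by (intro subsetD[OF M'(2)]) simp
  have MG: "M \<subseteq> carrier G" "M' \<subseteq> carrier G"
    using M M'(1) by (simp_all add: maximal_subgroup_def subgroup.subset)
  \<comment> \<open>A common element would make conjugates of \<open>M\<close> and \<open>M'\<close>
    coincide, and then \<open>x\<close> would lie in a conjugate of \<open>M\<close>.\<close>
  have "U M \<inter> U M' = {}"
  proof (rule ccontr)
    assume "U M \<inter> U M' \<noteq> {}"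
    then obtain u where uU: "u \<in> U M" "u \<in> U M'" by blast
    have mono: "conj_set g (K - {\<one>}) \<subseteq> conj_set g K" for g K by (auto simp: conj_set_def)
    obtain g where g: "g \<in> carrier G" "u \<in> conj_set g (M - {\<one>})" using uU(1) unfolding U_def by blast
    obtain h where h: "h \<in> carrier G" "u \<in> conj_set h (M' - {\<one>})" using uU(2) unfolding U_def by blast
    have u: "u \<in> conj_set g M \<inter> conj_set h M'"
      using subsetD[OF mono g(2)] subsetD[OF mono h(2)] by (rule IntI)
    have "conj_set g M = conj_set h M'"
    proof (rule ccontr)
      assume "conj_set g M \<noteq> conj_set h M'"
      then have "conj_set g M \<inter> conj_set h M' = {\<one>}"
        by (rule maximal_subgroups_inter_trivial[OF maximal_subgroup_conj_set[OF M g(1)]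
              maximal_subgroup_conj_set[OF M'(1) h(1)]])
      then show False using u subsetD[OF U_sub[OF M] uU(1)] by simp
    qed
    then have "conj_set (inv h) (conj_set g M) = M'" using conj_set_inv(1)[OF h(1) MG(2)] by simp
    then have "x \<in> conj_set (inv h \<otimes> g) M"
      using conj_set_mult[OF inv_closed[OF h(1)] g(1) MG(1)] xM' by simp
    then obtain m where m: "m \<in> M" "x = inv h \<otimes> g \<otimes> m \<otimes> inv (inv h \<otimes> g)"
      unfolding conj_set_def by blast
    have "m \<noteq> \<one>"
    proof
      assume "m = \<one>"
      then have "x = \<one>" using m(2) g(1) h(1) by simp
      with x(2) show False ..
    qed
    then have "x \<in> conj_set (inv h \<otimes> g) (M - {\<one>})"
      unfolding conj_set_def m(2) using m(1) by (intro imageI) simp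
    then have "x \<in> U M" unfolding U_def using g(1) h(1) by (intro UN_I) auto
    with x(3) show False ..
  qed
  moreover have finU: "finite (U N)" if "maximal_subgroup N" for N
    by (rule finite_subset[OF U_sub[OF that]]) (simp add: fin)
  ultimately have "card (U M) + card (U M') = card (U M \<union> U M')" 
    using M M'(1) by (simp add: card_Un_disjoint)
  also have "\<dots> \<le> card (carrier G - {\<one>})"
    using U_sub[OF M] U_sub[OF M'(1)] fin by (intro card_mono) auto
  also have "\<dots> < order G" using fin order_pos by (simp add: order_def)
  finally show False using half[OF M] half[OF M'(1)] by linarith
qed

end

lemma ex_proper_normal_subgroup: "\<exists>N. N \<lhd> G \<and> N \<noteq> {\<one>} \<and> N \<noteq> carrier G"
proof (rule ccontr)
  assume "\<not> ?thesis"
  then have "N = {\<one>} \<or> N = carrier G" if "N \<lhd> G" for N using that by simp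
  then show False by (rule simple_impossible)
qed

end

text \<open>This is the class equation: orbits of \<open>P\<close> on \<open>V\<close> have
  \<open>p\<close>-power size. If \<open>\<one>\<close> were the only fixed point, all other orbits
  would have size divisible by \<open>p\<close>, and \<open>card V\<close> would be \<open>1\<close>
  modulo \<open>p\<close>.\<close>

lemma (in group) p_subgroup_fixed_point:
  assumes "prime p" and P: "subgroup P G" "card P = p ^ a"
    and V: "V \<subseteq> carrier G" "finite V" "p dvd card V" "\<one> \<in> V"
      "\<And>x v. x \<in> P \<Longrightarrow> v \<in> V \<Longrightarrow> x \<otimes> v \<otimes> inv x \<in> V"
  shows "\<exists>v \<in> V. v \<noteq> \<one> \<and> (\<forall>x \<in> P. x \<otimes> v = v \<otimes> x)"
proof (rule ccontr)
  assume nofix: "\<not> ?thesis"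
  \<comment> \<open>Conjugation is taken on all of \<open>G\<close>; as \<open>P\<close> preserves
    \<open>V\<close>, orbits of points of \<open>V\<close> stay in \<open>V\<close>.\<close>
  define \<phi> where "\<phi> = (\<lambda>g. \<lambda>h \<in> carrier G. g \<otimes> h \<otimes> inv g)"
  have PG: "x \<in> carrier G" if "x \<in> P" for x using subgroup.mem_carrier[OF P(1) that] .
  have "group_action (G\<lparr>carrier := P\<rparr>) (carrier G) \<phi>"
  proof -
    have "\<phi> \<in> hom G (BijGroup (carrier G))" unfolding \<phi>_def by (rule conjugation_is_hom)
    then have "\<phi> \<in> hom (G\<lparr>carrier := P\<rparr>) (BijGroup (carrier G))"
      using PG by (auto simp: hom_def Pi_iff)
    then show ?thesis
      using subgroup_imp_group[OF P(1)] group_BijGroup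
      by (simp add: group_action_def group_hom_def group_hom_axioms_def)
  qed
  then interpret A: group_action "G\<lparr>carrier := P\<rparr>" "carrier G" \<phi> .
  define orb where "orb v = orbit (G\<lparr>carrier := P\<rparr>) \<phi> v" for v
  have orb: "orb v = {x \<otimes> v \<otimes> inv x | x. x \<in> P}" if "v \<in> V" for v
    using that V(1) by (auto simp: orb_def orbit_def \<phi>_def)
  have self: "v \<in> orb v" if "v \<in> V" for v
    unfolding orb_def using that V(1) by (intro A.orbit_refl) auto
  have sub: "orb v \<subseteq> V" if "v \<in> V" for v using that V(5) by (auto simp: orb)
  have "V = \<Union>(orb ` V)" using self sub by auto
  moreover have "card (\<Union>(orb ` V)) = (\<Sum>X \<in> orb ` V. card X)"
  proof (rule card_Union_disjoint)
    have mem: "orb v \<in> orbits (G\<lparr>carrier := P\<rparr>) (carrier G) \<phi>" if "v \<in> V" for v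
      using that V(1) by (auto simp: orbits_def orb_def)
    show "pairwise disjnt (orb ` V)"
    proof (rule pairwiseI)
      fix X Y assume XY: "X \<in> orb ` V" "Y \<in> orb ` V" "X \<noteq> Y"
      then show "disjnt X Y" using A.disjoint_union[of X Y] mem by (auto simp: disjnt_def)
    qed
    show "finite X" if "X \<in> orb ` V" for X using that sub V(2) finite_subset by (metis imageE)
  qed
  ultimately have card_V: "card V = (\<Sum>X \<in> orb ` V. card X)" by simp
  have dvd: "p dvd card (orb v)" if v: "v \<in> V" "v \<noteq> \<one>" for v
  proof -
    have "card (orb v) * card (stabilizer (G\<lparr>carrier := P\<rparr>) \<phi> v) = p ^ a"
      unfolding orb_def using A.orbit_stabilizer_theorem[of v] v V(1) P(2) by (auto simp: order_def)
    then have "card (orb v) dvd p ^ a" by (metis dvd_triv_left)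
    then obtain i where i: "card (orb v) = p ^ i" using divides_primepow_nat[OF assms(1)] by blast
    have "i \<noteq> 0"
    proof
      assume "i = 0"
      with i have "card (orb v) = 1" by simp
      then obtain w where w: "orb v = {w}" by (rule card_1_singletonE)
      have "x \<otimes> v = v \<otimes> x" if x: "x \<in> P" for x
      proof -
        have vG: "v \<in> carrier G" "x \<in> carrier G" using v V(1) PG[OF x] by auto
        have "x \<otimes> v \<otimes> inv x \<in> orb v" using x v by (auto simp: orb)
        then have "x \<otimes> v \<otimes> inv x = v" using self[OF v(1)] w by simp
        then have "x \<otimes> v \<otimes> inv x \<otimes> x = v \<otimes> x" by simp
        then show ?thesis using vG by (simp add: m_assoc)
      qed
      with nofix v show False by blast
    qed
    then show ?thesis using i by simp
  qed
  have orb1: "orb \<one> = {\<one>}"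
  proof -
    have "x \<otimes> \<one> \<otimes> inv x = \<one>" if "x \<in> P" for x using PG[OF that] by simp
    then have "orb \<one> \<subseteq> {\<one>}" by (auto simp: orb[OF V(4)])
    then show ?thesis using self[OF V(4)] by blast
  qed
  have "(\<Sum>X \<in> orb ` V. card X) = card (orb \<one>) + (\<Sum>X \<in> orb ` V - {orb \<one>}. card X)"
    using V(2,4) by (intro sum.remove) auto
  then have "card V = 1 + (\<Sum>X \<in> orb ` V - {orb \<one>}. card X)"
    unfolding card_V orb1 by simp
  moreover have "p dvd (\<Sum>X \<in> orb ` V - {orb \<one>}. card X)"
  proof (rule dvd_sum)
    fix X assume "X \<in> orb ` V - {orb \<one>}"
    then obtain v where "X = orb v" "v \<in> V" "v \<noteq> \<one>" by auto
    then show "p dvd card X" using dvd by simp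
  qed
  ultimately have "p dvd 1" using V(3) by (metis dvd_add_left_iff)
  with assms(1) show False by simp
qed

lemma (in group) conj_nat_pow:
  assumes "x \<in> carrier G" "a \<in> carrier G"
  shows "(x \<otimes> a \<otimes> inv x) [^] (n :: nat) = x \<otimes> a [^] n \<otimes> inv x"
  by (induction n) (use assms in \<open>simp_all add: m_assoc\<close>)

lemma (in group) ex_element_of_prime_order:
  assumes "finite (carrier G)" "z \<in> carrier G" "z \<noteq> \<one>"
  shows "\<exists>p k. prime p \<and> z [^] (k :: nat) \<noteq> \<one> \<and> (z [^] k) [^] (p :: nat) = \<one>"
proof -
  have "ord z \<noteq> 1" using assms ord_eq_1 by blast
  then obtain p where p: "prime p" "p dvd ord z" using prime_factor_nat by blast
  then obtain k where k: "ord z = p * k" by blast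
  have "ord z \<ge> 1" by (rule ord_ge_1[OF assms(1,2)])
  then have "k > 0" using k by (cases k) auto
  then have "\<not> ord z dvd k" using k prime_gt_1_nat[OF p(1)] by (auto dest: dvd_imp_le)
  then have "z [^] k \<noteq> \<one>" using pow_eq_id[OF assms(2)] by simp
  moreover have "(z [^] k) [^] p = \<one>"
    using assms(2) k pow_ord_eq_1[OF assms(2)] by (simp add: nat_pow_pow mult.commute)
  ultimately show ?thesis using p(1) by blast
qed

context minimal_nonnilpotent
begin

text \<open>\<open>V\<close> consists of the elements of exponent \<open>p\<close> in the center of a normal subgroup. If all
  elements of order prime to \<open>p\<close> centralized \<open>V\<close>, then a fixed point in \<open>V\<close> of a Sylow
  \<open>p\<close>-subgroup would be central.\<close>

theorem ex_elementary_abelian_section: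
  "\<exists>p q V g v. prime p \<and> prime q \<and> p \<noteq> q \<and> subgroup V G \<and>
    (\<forall>x \<in> V. \<forall>y \<in> V. x \<otimes> y = y \<otimes> x) \<and> (\<forall>x \<in> V. x [^] (p :: nat) = \<one>) \<and>
    g \<in> carrier G \<and> (\<forall>x \<in> V. inv g \<otimes> x \<otimes> g \<in> V) \<and>
    v \<in> V \<and> g \<otimes> v \<noteq> v \<otimes> g \<and> g [^] (q :: nat) \<otimes> v = v \<otimes> g [^] q"
proof -
  obtain N where N: "N \<lhd> G" "N \<noteq> {\<one>}" "N \<noteq> carrier G" using ex_proper_normal_subgroup by blast
  interpret N: normal N G by fact
  have NG: "x \<in> carrier G" if "x \<in> N" for x using that by (rule N.mem_carrier)
  have Nconj: "x \<otimes> h \<otimes> inv x \<in> N" if "x \<in> carrier G" "h \<in> N" for x h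
    using that N.inv_op_closed2 by simp
  obtain z where z: "z \<in> N" "z \<noteq> \<one>" "\<And>y. y \<in> N \<Longrightarrow> z \<otimes> y = y \<otimes> z"
    using group.nilpotent_center_nontrivial[OF subgroup_imp_group[OF N.is_subgroup]
        proper[OF N.is_subgroup N(3)]] N(2) by auto
  obtain p k where p: "prime p" "z [^] (k :: nat) \<noteq> \<one>" "(z [^] k) [^] (p :: nat) = \<one>"
    using ex_element_of_prime_order[OF fin NG[OF z(1)] z(2)] by blast
  define C where "C W = {x \<in> carrier G. \<forall>v \<in> W. x \<otimes> v = v \<otimes> x}" for W
  have C: "subgroup (C W) G" if "W \<subseteq> carrier G" for W
    unfolding C_def by (rule subgroup_centralizer[OF that])
  have CD: "x \<otimes> v = v \<otimes> x" if "x \<in> C W" "v \<in> W" for x v W using that unfolding C_def by blast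
  have CI: "x \<in> C W" if "x \<in> carrier G" "\<And>v. v \<in> W \<Longrightarrow> x \<otimes> v = v \<otimes> x" for x W
    using that unfolding C_def by blast
  \<comment> \<open>\<open>Z\<close> is the center of \<open>N\<close>; it contains
    \<open>z\<close>, and a power of \<open>z\<close> is a nontrivial element of
    \<open>V\<close>.\<close>
  define Z where "Z = N \<inter> C N"
  define V where "V = {a \<in> Z. a [^] p = \<one>}"
  have NGs: "N \<subseteq> carrier G" by (rule N.subset)
  have Z: "subgroup Z G" unfolding Z_def by (rule subgroups_Inter_pair[OF N.is_subgroup C[OF NGs]])
  have ZG: "a \<in> carrier G" if "a \<in> Z" for a using that NG by (auto simp: Z_def)
  have Zcomm: "a \<otimes> b = b \<otimes> a" if "a \<in> Z" "b \<in> Z" for a b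
    using that unfolding Z_def by (intro CD[of a N]) blast+
  have V: "subgroup V G"
  proof (rule subgroupI)
    show "V \<subseteq> carrier G" using ZG by (auto simp: V_def)
    have "\<one> \<in> V" using subgroup.one_closed[OF Z] by (simp add: V_def)
    then show "V \<noteq> {}" by blast
    show "inv a \<in> V" if "a \<in> V" for a
      using that ZG subgroup.m_inv_closed[OF Z] by (simp add: V_def nat_pow_inv)
    show "a \<otimes> b \<in> V" if "a \<in> V" "b \<in> V" for a b
    proof -
      have ab: "a \<in> Z" "b \<in> Z" "a [^] p = \<one>" "b [^] p = \<one>"
        using that by (auto simp: V_def)
      then have "(a \<otimes> b) [^] p = \<one>"
        using pow_mult_distrib[OF Zcomm[OF ab(1,2)] ZG[OF ab(1)] ZG[OF ab(2)], of p] by simp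
      then show ?thesis using subgroup.m_closed[OF Z ab(1,2)] by (simp add: V_def)
    qed
  qed
  have VG: "a \<in> carrier G" if "a \<in> V" for a using that by (rule subgroup.mem_carrier[OF V])
  \<comment> \<open>\<open>V\<close> is defined from \<open>N\<close> without choices, so
    conjugation by elements of \<open>G\<close> preserves it along with \<open>N\<close>.\<close>
  have Vconj: "x \<otimes> a \<otimes> inv x \<in> V" if x: "x \<in> carrier G" and a: "a \<in> V" for x a
  proof -
    have aN: "a \<in> N" "a \<in> carrier G" "a [^] p = \<one>"
      using a VG by (auto simp: V_def Z_def)
    have "x \<otimes> a \<otimes> inv x \<otimes> y = y \<otimes> (x \<otimes> a \<otimes> inv x)" if y: "y \<in> N" for y
    proof -
      have yN: "inv x \<otimes> y \<otimes> x \<in> N" using Nconj[of "inv x" y] x y by simp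
      have yG: "y \<in> carrier G" using NG y .
      have "x \<otimes> a \<otimes> inv x \<otimes> y = x \<otimes> (a \<otimes> (inv x \<otimes> y \<otimes> x)) \<otimes> inv x"
        using x aN yG by (simp add: m_assoc)
      also have "a \<otimes> (inv x \<otimes> y \<otimes> x) = (inv x \<otimes> y \<otimes> x) \<otimes> a"
        using a yN unfolding V_def Z_def by (intro CD[of a N]) blast+
      also have "x \<otimes> \<dots> \<otimes> inv x = y \<otimes> (x \<otimes> a \<otimes> inv x)"
        using x aN yG by (simp add: m_assoc)
      finally show ?thesis .
    qed
    moreover have "(x \<otimes> a \<otimes> inv x) [^] p = \<one>"
      using conj_nat_pow[OF x aN(2), of p] aN x by simp
    moreover have "x \<otimes> a \<otimes> inv x \<in> carrier G" using x aN by simp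
    ultimately show ?thesis using Nconj[OF x aN(1)] CI[of "x \<otimes> a \<otimes> inv x" N]
      unfolding V_def Z_def by blast
  qed
  define u where "u = z [^] k"
  have "z \<in> Z" unfolding Z_def using z(1) CI[OF NG[OF z(1)] z(3)] by blast
  then have "z [^] j \<in> Z" for j :: nat
    by (induction j) (use subgroup.one_closed[OF Z] subgroup.m_closed[OF Z] in auto)
  then have u: "u \<in> V" "u \<noteq> \<one>" using p by (auto simp: V_def u_def)
  have VGs: "V \<subseteq> carrier G" by (rule subgroup.subset[OF V])
  have "\<exists>q g. prime q \<and> q \<noteq> p \<and> g \<in> carrier G \<and> g \<notin> C V \<and> g [^] (q :: nat) \<in> C V"
  proof (rule ccontr)
    assume no: "\<not> ?thesis"
    \<comment> \<open>By induction on \<open>j\<close>, the power \<open>g [^] q\<close> centralizes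
      \<open>V\<close>; since \<open>no\<close> forbids a pair \<open>q\<close>, \<open>g\<close> as
      claimed, so does \<open>g\<close>.\<close>
    have q_elem: "g \<in> C V" if q: "prime q" "q \<noteq> p" and g: "g \<in> carrier G" "g [^] (q ^ j) = \<one>"
      for q j :: nat and g
      using g
    proof (induction j arbitrary: g)
      case 0
      then show ?case using subgroup.one_closed[OF C[OF VGs]] by simp
    next
      case (Suc j)
      have "(g [^] q) [^] (q ^ j) = \<one>" using Suc.prems by (simp add: nat_pow_pow)
      then have "g [^] q \<in> C V" using Suc.prems(1) by (intro Suc.IH) auto
      with no q Suc.prems(1) show ?case by blast
    qed
    have sylow: "\<exists>Q. subgroup Q G \<and> card Q = q ^ multiplicity q (order G)" if "prime q" for q
    proof -
      obtain m where "order G = q ^ multiplicity q (order G) * m"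
        using multiplicity_dvd[of q "order G"] by blast
      from sylow_thm[OF that is_group this fin] show ?thesis .
    qed
    obtain P where P: "subgroup P G" "card P = p ^ multiplicity p (order G)" using sylow[OF p(1)] by blast
    have finV: "finite V" using VGs fin by (rule finite_subset)
    have ordu: "ord u = p"
    proof -
      have "ord u dvd p" using pow_eq_id[OF VG[OF u(1)], of p] u(1) by (simp add: V_def)
      moreover have "ord u \<noteq> 1" using ord_eq_1[OF VG[OF u(1)]] u(2) by simp
      ultimately show ?thesis using p(1) by (auto simp: prime_nat_iff)
    qed
    have "p dvd card V"
    proof -
      interpret V': group "G\<lparr>carrier := V\<rparr>" by (rule subgroup_imp_group[OF V])
      have "u [^]\<^bsub>G\<lparr>carrier := V\<rparr>\<^esub> j = u [^] j" for j :: nat by (simp add: nat_pow_consistent[symmetric])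
      then have "V'.ord u = ord u"
        using u(1) VG[OF u(1)] by (intro V'.ord_unique[THEN iffD2]) (auto simp: pow_eq_id)
      then show ?thesis using V'.ord_dvd_group_order[of u] finV u(1) ordu by (simp add: order_def)
    qed
    then obtain v where v: "v \<in> V" "v \<noteq> \<one>" "\<forall>x \<in> P. x \<otimes> v = v \<otimes> x"
      using p_subgroup_fixed_point[OF p(1) P VGs finV _ subgroup.one_closed[OF V]] Vconj
        subgroup.mem_carrier[OF P(1)] by blast
    have vG: "v \<in> carrier G" by (rule VG[OF v(1)])
    have D: "subgroup (C {v}) G" using vG by (intro C) simp
    \<comment> \<open>The centralizer of \<open>v\<close> contains a Sylow subgroup for every prime:
      \<open>P\<close> by the choice of \<open>v\<close>, the others by
      \<open>q_elem\<close>.\<close>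
    have q_dvd: "q ^ multiplicity q (order G) dvd card (C {v})" if q: "prime q" for q
    proof -
      have "\<exists>Q. subgroup Q G \<and> card Q = q ^ multiplicity q (order G) \<and> Q \<subseteq> C {v}"
      proof (cases "q = p")
        case True
        have "x \<in> C {v}" if "x \<in> P" for x
          using v(3) that by (intro CI subgroup.mem_carrier[OF P(1)]) auto
        then have "P \<subseteq> C {v}" by blast
        with P True show ?thesis by blast
      next
        case False
        obtain Q where Q: "subgroup Q G" "card Q = q ^ multiplicity q (order G)" using sylow[OF q] by blast
        have "g \<in> C {v}" if g: "g \<in> Q" for g
        proof -
          have gG: "g \<in> carrier G" using subgroup.mem_carrier[OF Q(1) g] .
          interpret Q: group "G\<lparr>carrier := Q\<rparr>" by (rule subgroup_imp_group[OF Q(1)])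
          have "g [^]\<^bsub>G\<lparr>carrier := Q\<rparr>\<^esub> order (G\<lparr>carrier := Q\<rparr>) = \<one>\<^bsub>G\<lparr>carrier := Q\<rparr>\<^esub>"
            using g by (intro Q.pow_order_eq_1) simp
          then have "g [^] (q ^ multiplicity q (order G)) = \<one>"
            by (simp add: order_def Q(2) nat_pow_consistent[symmetric])
          then have "g \<in> C V" by (rule q_elem[OF q False gG])
          then show ?thesis using CD[OF _ v(1)] gG by (intro CI) auto
        qed
        with Q show ?thesis by blast
      qed
      then obtain Q where Q: "subgroup Q G" "card Q = q ^ multiplicity q (order G)" "Q \<subseteq> C {v}"
        by blast
      have "card Q dvd order (G\<lparr>carrier := C {v}\<rparr>)"
        using group.lagrange[OF subgroup_imp_group[OF D] subgroup_incl[OF Q(1) D Q(3)]]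
        by (metis dvd_triv_right)
      then show ?thesis by (simp add: Q(2) order_def)
    qed
    have DG: "C {v} \<subseteq> carrier G" by (rule subgroup.subset[OF D])
    have "finite (C {v})" using DG fin by (rule finite_subset)
    then have pos: "card (C {v}) > 0" using subgroup.one_closed[OF D] by (auto simp: card_gt_0_iff)
    have opos: "order G > 0" using fin by (simp add: order_gt_0_iff_finite)
    \<comment> \<open>Comparing multiplicities prime by prime makes the centralizer of
      \<open>v\<close> all of \<open>G\<close>, so \<open>v\<close> is a nontrivial central
      element.\<close>
    have "order G dvd card (C {v})"
    proof (rule multiplicity_le_imp_dvd)
      fix q :: nat assume q: "prime q"
      show "multiplicity q (order G) \<le> multiplicity q (card (C {v}))"
        using q_dvd[OF q] pos q by (intro multiplicity_geI) auto
    qed (use opos in simp)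
    then have "card (carrier G) \<le> card (C {v})" using pos by (simp add: order_def dvd_imp_le)
    then have "C {v} = carrier G" using DG fin by (intro card_seteq)
    then have "y \<in> C {v}" if "y \<in> carrier G" for y using that by simp
    then have "\<forall>y \<in> carrier G. v \<otimes> y = y \<otimes> v"
      using CD[of _ "{v}" v] by simp
    from center[OF vG this] v(2) show False by simp
  qed
  then obtain q g where q: "prime q" "q \<noteq> p" "g \<in> carrier G" "g \<notin> C V" "g [^] (q :: nat) \<in> C V"
    by blast
  then obtain v where v: "v \<in> V" "g \<otimes> v \<noteq> v \<otimes> g" using CI[of g V] by blast
  have "g [^] q \<otimes> v = v \<otimes> g [^] q" by (rule CD[OF q(5) v(1)])
  moreover have "\<forall>x \<in> V. inv g \<otimes> x \<otimes> g \<in> V"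
    using Vconj[of "inv g"] q(3) by simp
  moreover have "\<forall>x \<in> V. x [^] p = \<one>" by (simp add: V_def)
  moreover have "\<forall>x \<in> V. \<forall>y \<in> V. x \<otimes> y = y \<otimes> x"
    using Zcomm unfolding V_def by blast
  ultimately show ?thesis using p(1) q(1,2,3) V v
    by (intro exI[of _ p] exI[of _ q] exI[of _ V] exI[of _ g] exI[of _ v] conjI) auto
qed

end

subsection \<open>Fourier inversion modulo an ideal\<close>

text \<open>The ideals of interest are annihilators of an element of a \<open>p\<close>-group under an automorphism \<open>X\<close>
  of order \<open>q\<close>.\<close>

locale cyclotomic_ideal =
  fixes I :: "int poly set" and p q :: nat and X :: "int poly"
  assumes zero_I: "0 \<in> I"
    and add_I: "f \<in> I \<Longrightarrow> g \<in> I \<Longrightarrow> f + g \<in> I"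
    and mult_I: "f \<in> I \<Longrightarrow> g * f \<in> I"
    and p_I: "of_nat p \<in> I"
    and cyclotomic_I: "(\<Sum>i<q. X ^ i) \<in> I"
    and one_I: "1 \<notin> I"
    and prime_p: "prime p" and prime_q: "prime q" and p_neq_q: "p \<noteq> q"
begin

lemma diff_I: "f \<in> I \<Longrightarrow> g \<in> I \<Longrightarrow> f - g \<in> I"
  using add_I[of f "-1 * g"] mult_I[of g "-1"] by simp

lemma sum_I: "(\<And>x. x \<in> A \<Longrightarrow> f x \<in> I) \<Longrightarrow> sum f A \<in> I"
  by (induction A rule: infinite_finite_induct) (auto simp: zero_I add_I)

lemma trans_I: "f - g \<in> I \<Longrightarrow> g - h \<in> I \<Longrightarrow> f - h \<in> I"
  using add_I[of "f - g" "g - h"] by simp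

lemma prod_diff_I:
  assumes "f - f' \<in> I" "g - g' \<in> I"
  shows "f * g - f' * g' \<in> I"
proof -
  have "f * g - f' * g' = f * (g - g') + g' * (f - f')" by (simp add: algebra_simps)
  then show ?thesis using assms by (simp add: add_I mult_I)
qed

lemma power_diff_one_I:
  assumes "f - 1 \<in> I"
  shows "f ^ m - 1 \<in> I"
  using mult_I[OF assms, of "\<Sum>i<m. f ^ i"] by (simp add: power_diff_1_eq mult.commute)

lemma X_power_mult_q: "X ^ (q * m) - 1 \<in> I"
proof -
  have "X ^ q - 1 \<in> I" unfolding power_diff_1_eq by (rule mult_I[OF cyclotomic_I])
  then show ?thesis unfolding power_mult by (rule power_diff_one_I)
qed

lemma X_power_mod_q: "X ^ m - X ^ (m mod q) \<in> I"
proof -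
  have "X ^ m = X ^ (m mod q) * X ^ (q * (m div q))" by (simp flip: power_add)
  then have "X ^ m - X ^ (m mod q) = X ^ (m mod q) * (X ^ (q * (m div q)) - 1)"
    by (simp add: algebra_simps)
  then show ?thesis using X_power_mult_q mult_I by metis
qed

text \<open>The ideal contains \<open>p\<close> but not \<open>1\<close>; by Bezout an integer prime
  to \<open>p\<close> cannot lie in it.\<close>

lemma of_int_I_imp_dvd:
  assumes "of_int z \<in> I"
  shows "int p dvd z"
proof (rule ccontr)
  assume "\<not> int p dvd z"
  then have "coprime (int p) z" using prime_p by (simp add: prime_imp_coprime)
  then obtain u v where "u * int p + v * z = 1" by (metis bezout_int coprime_iff_gcd_eq_1)
  then have "of_int u * of_nat p + of_int v * of_int z = (1 :: int poly)"
    by (metis of_int_1 of_int_add of_int_mult of_int_of_nat_eq)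
  moreover have "of_int u * of_nat p + of_int v * of_int z \<in> I"
    using p_I assms by (intro add_I mult_I)
  ultimately show False using one_I by simp
qed

lemma q_not_dvd: "\<not> int p dvd int q ^ m"
  using prime_p prime_q p_neq_q prime_dvd_power primes_dvd_imp_eq
  by (metis int_dvd_int_iff of_nat_power)

text \<open>Orthogonality of characters, with \<open>X\<close> as a root of unity of order
  \<open>q\<close> modulo \<open>I\<close>: for \<open>d\<close> prime to \<open>q\<close>,
  multiplication by \<open>d\<close> permutes the residues, and the sum becomes the one in
  \<open>cyclotomic_I\<close>.\<close>

lemma character_sum:
  "(\<Sum>j<q. X ^ (j * d)) - (if q dvd d then of_nat q else 0) \<in> I"
proof (cases "q dvd d")
  case True
  then obtain m where m: "d = q * m" by blast
  have "(\<Sum>j<q. X ^ (j * d)) - of_nat q = (\<Sum>j<q. X ^ (q * (j * m)) - 1)"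
    by (simp add: m sum_subtractf mult.left_commute)
  then show ?thesis using True X_power_mult_q by (auto intro: sum_I)
next
  case False
  have inj: "inj_on (\<lambda>j. j * d mod q) {..<q}"
  proof (rule linorder_inj_onI)
    fix i j assume ij: "i < j" "i \<in> {..<q}" "j \<in> {..<q}"
    show "i * d mod q \<noteq> j * d mod q"
    proof
      assume "i * d mod q = j * d mod q"
      then have "q dvd j * d - i * d"
        using ij by (metis mod_eq_dvd_iff_nat less_imp_le mult_le_mono1)
      then have "q dvd (j - i) * d" by (simp add: diff_mult_distrib)
      with False prime_q have "q dvd j - i" by (simp add: prime_dvd_mult_iff)
      with ij show False by (auto dest: dvd_imp_le)
    qed
  qed (auto)
  have "(\<lambda>j. j * d mod q) ` {..<q} = {..<q}"
    using inj prime_gt_0_nat[OF prime_q] by (intro endo_inj_surj) auto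
  with inj have "(\<Sum>j<q. X ^ (j * d mod q)) = (\<Sum>j<q. X ^ j)"
    by (metis (no_types, lifting) sum.reindex_cong)
  moreover have "(\<Sum>j<q. X ^ (j * d)) - (\<Sum>j<q. X ^ (j * d mod q)) \<in> I"
    unfolding sum_subtractf[symmetric] by (intro sum_I X_power_mod_q)
  ultimately have "(\<Sum>j<q. X ^ (j * d)) - (\<Sum>j<q. X ^ j) \<in> I" by simp
  from add_I[OF this cyclotomic_I] False show ?thesis by simp
qed

lemma character_sum_PiE:
  assumes "finite D"
  shows "(\<Sum>k\<in>PiE D (\<lambda>_. {..<q}). X ^ (\<Sum>i\<in>D. k i * d i)) -
    (if \<forall>i\<in>D. q dvd d i then of_nat q ^ card D else 0) \<in> I"
proof -
  have "(\<Prod>i\<in>D. \<Sum>j<q. X ^ (j * d i)) - (if \<forall>i\<in>D. q dvd d i then of_nat q ^ card D else 0) \<in> I"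
    using assms
  proof (induction D)
    case empty
    show ?case by (simp add: zero_I)
  next
    case (insert x D)
    from prod_diff_I[OF character_sum[of "d x"] insert.IH] insert.hyps show ?case
      by (auto split: if_splits)
  qed
  moreover have "(\<Prod>i\<in>D. \<Sum>j<q. X ^ (j * d i)) =
      (\<Sum>k\<in>PiE D (\<lambda>_. {..<q}). X ^ (\<Sum>i\<in>D. k i * d i))"
    using assms by (simp add: prod_sum_PiE power_sum)
  ultimately show ?thesis by simp
qed

text \<open>\<open>X\<close> has order exactly \<open>q\<close> modulo \<open>I\<close>: if
  \<open>X\<close> to the power \<open>?d\<close> were \<open>1\<close> with \<open>?d\<close> prime
  to \<open>q\<close>, its character sum would be both \<open>q\<close> and \<open>0\<close>, and
  \<open>q\<close> would lie in \<open>I\<close>.\<close>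

lemma X_power_diff_imp_mod_eq:
  assumes "X ^ c - X ^ c' \<in> I"
  shows "c mod q = c' mod q"
proof -
  \<comment> \<open>\<open>(q - 1) * c'\<close> represents \<open>- c'\<close> modulo
    \<open>q\<close>, so \<open>?d\<close> stands for \<open>c - c'\<close>.\<close>
  let ?d = "c + (q - 1) * c'"
  have q: "q \<ge> 1" using prime_gt_0_nat[OF prime_q] by simp
  have e: "(q - 1) * c' + c' = q * c'" using q by (simp add: algebra_simps diff_mult_distrib)
  have "X ^ ((q - 1) * c') * (X ^ c - X ^ c') = X ^ ?d - X ^ ((q - 1) * c' + c')"
    by (simp add: power_add algebra_simps)
  then have "X ^ ?d - X ^ (q * c') \<in> I" using mult_I[OF assms] e by metis
  then have d: "X ^ ?d - 1 \<in> I" using X_power_mult_q trans_I by blast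
  have "X ^ (j * ?d) - 1 \<in> I" for j
    using power_diff_one_I[OF d, of j] by (simp only: mult.commute flip: power_mult)
  then have "(\<Sum>j<q. X ^ (j * ?d) - 1) \<in> I" by (intro sum_I)
  then have s: "(\<Sum>j<q. X ^ (j * ?d)) - of_nat q \<in> I" by (simp add: sum_subtractf)
  have "q dvd ?d"
  proof (rule ccontr)
    assume "\<not> q dvd ?d"
    with character_sum[of ?d] have "(\<Sum>j<q. X ^ (j * ?d)) \<in> I" by simp
    from diff_I[OF this s] have "of_int (int q) \<in> I" by simp
    from of_int_I_imp_dvd[OF this] show False using q_not_dvd[of 1] by simp
  qed
  then have "(c + (q - 1) * c' + c') mod q = c' mod q"
    by (metis add_0 mod_add_left_eq dvd_eq_mod_eq_0)
  then show ?thesis using e by (simp add: add.assoc)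
qed

end

section \<open>Occurrence polynomials and their Fourier transform\<close>

definition weight :: "(nat \<Rightarrow> nat) \<Rightarrow> nat list \<Rightarrow> nat" where
  "weight k w = (\<Sum>i\<leftarrow>w. if i = 0 then 0 else k i)"

text \<open>When letter \<open>i > 0\<close> is replaced by the \<open>k i\<close>-th power of one
  element, this records the base part of the word: an occurrence of \<open>0\<close> contributes
  \<open>X\<close> to the weight of the suffix after it.\<close>

primrec occurrence_poly :: "'a \<Rightarrow> (nat \<Rightarrow> nat) \<Rightarrow> nat list \<Rightarrow> ('a :: comm_ring_1)" where
  "occurrence_poly X k [] = 0"
| "occurrence_poly X k (l # w) = occurrence_poly X k w + (if l = 0 then X ^ weight k w else 0)"

lemma weight_simps [simp]:
  "weight k [] = 0" "weight k (l # w) = (if l = 0 then 0 else k l) + weight k w"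
  by (simp_all add: weight_def)

lemma weight_eq_sum_count:
  assumes "finite D" "0 \<notin> D" "set w \<subseteq> insert 0 D"
  shows "weight k w = (\<Sum>i\<in>D. k i * count_list w i)"
  using assms(3)
proof (induction w)
  case (Cons l w)
  have "(\<Sum>i\<in>D. k i * count_list (l # w) i) =
      (\<Sum>i\<in>D. k i * count_list w i + (if i = l then k l else 0))"
    by (intro sum.cong) auto
  also have "\<dots> = weight k w + (if l \<in> D then k l else 0)"
    using Cons assms(1) by (simp add: sum.distrib)
  finally show ?case using Cons.prems assms(2) by auto
qed simp

context cyclotomic_ideal
begin

text \<open>This is Fourier inversion. An occurrence of \<open>0\<close> before a suffix with
  exponents \<open>e\<close> contributes the sum over \<open>k\<close> of \<open>X\<close> to the
  inner product of \<open>k\<close> with \<open>e - a\<close>, which is \<open>q ^ card D\<close> if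
  \<open>e = a\<close> and \<open>0\<close> otherwise. Again \<open>q - a i\<close> represents
  \<open>- a i\<close>.\<close>

lemma occurrence_poly_fourier:
  assumes D: "finite D" "0 \<notin> D" "set w \<subseteq> insert 0 D"
    and a: "\<And>i. i \<notin> D \<Longrightarrow> a i = 0" "\<And>i. a i < q"
  shows "(\<Sum>k\<in>PiE D (\<lambda>_. {..<q}). X ^ (\<Sum>i\<in>D. k i * (q - a i)) * occurrence_poly X k w) -
    of_nat (q ^ card D * occurrences q a w) \<in> I"
  using D(3)
proof (induction w)
  case Nil
  show ?case by (simp add: zero_I)
next
  case (Cons l w)
  let ?F = "\<lambda>w. \<Sum>k\<in>PiE D (\<lambda>_. {..<q}). X ^ (\<Sum>i\<in>D. k i * (q - a i)) * occurrence_poly X k w"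
  have IH: "?F w - of_nat (q ^ card D * occurrences q a w) \<in> I" using Cons by simp
  show ?case
  proof (cases "l = 0")
    case False
    with IH show ?thesis by simp
  next
    case True
    let ?d = "\<lambda>i. (q - a i) + count_list w i"
    have iff: "(\<forall>i\<in>D. q dvd ?d i) \<longleftrightarrow> exponents q w = a"
    proof -
      have "q dvd ?d i \<longleftrightarrow> count_list w i mod q = a i" for i
      proof
        assume "q dvd ?d i"
        then have "(?d i + a i) mod q = a i mod q" by (metis add_0 mod_add_left_eq dvd_eq_mod_eq_0)
        moreover have "?d i + a i = count_list w i + q" using a(2)[of i] by simp
        ultimately show "count_list w i mod q = a i" using a(2)[of i] by simp
      next
        assume *: "count_list w i mod q = a i"
        have "?d i mod q = ((q - a i) + a i) mod q" by (simp add: *[symmetric] mod_simps)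
        also have "(q - a i) + a i = q" using a(2)[of i] by simp
        finally show "q dvd ?d i" by (simp add: dvd_eq_mod_eq_0)
      qed
      moreover have "exponents q w i = a i" if "i \<notin> D" for i
        using that a(1) Cons.prems count_list_0_iff[of w i] by (auto simp: exponents_def)
      moreover have "exponents q w i = count_list w i mod q" if "i \<in> D" for i
        using that D(2) by (auto simp: exponents_def)
      ultimately show ?thesis by (auto simp: fun_eq_iff) metis
    qed
    have w: "weight k w = (\<Sum>i\<in>D. k i * count_list w i)" for k
      using Cons.prems by (intro weight_eq_sum_count D) auto
    have "?F (l # w) = ?F w + (\<Sum>k\<in>PiE D (\<lambda>_. {..<q}). X ^ (\<Sum>i\<in>D. k i * ?d i))"
      by (simp add: True w algebra_simps sum.distrib flip: power_add)
    moreover have "of_nat (q ^ card D * occurrences q a (l # w)) =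
        of_nat (q ^ card D * occurrences q a w) +
        (if \<forall>i\<in>D. q dvd ?d i then of_nat q ^ card D else (0 :: int poly))"
      unfolding iff by (simp add: True algebra_simps)
    ultimately show ?thesis
      using add_I[OF IH character_sum_PiE[OF D(1), of ?d]] by (simp only: add_diff_add)
  qed
qed

lemma occurrences_mod_eq:
  assumes law: "\<And>k. occurrence_poly X k w - occurrence_poly X k w' \<in> I"
    and a: "finite {i. a i \<noteq> 0}" "a 0 = 0" "\<And>i. a i < q"
  shows "occurrences q a w mod p = occurrences q a w' mod p"
proof -
  \<comment> \<open>One index set serves for both words and for the support of \<open>a\<close>, so
    both transforms range over the same \<open>k\<close>.\<close>
  define D where "D = (set w \<union> set w' \<union> {i. a i \<noteq> 0}) - {0}"
  define F where "F = (\<lambda>w. \<Sum>k\<in>PiE D (\<lambda>_. {..<q}).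
    X ^ (\<Sum>i\<in>D. k i * (q - a i)) * occurrence_poly X k w)"
  let ?N = "\<lambda>w. q ^ card D * occurrences q a w"
  have D: "finite D" "0 \<notin> D" "\<And>i. i \<notin> D \<Longrightarrow> a i = 0"
    using a by (auto simp: D_def)
  have 1: "F w - of_nat (?N w) \<in> I" "F w' - of_nat (?N w') \<in> I"
    unfolding F_def by (intro occurrence_poly_fourier D a; auto simp: D_def)+
  have "F w - F w' = (\<Sum>k\<in>PiE D (\<lambda>_. {..<q}).
      X ^ (\<Sum>i\<in>D. k i * (q - a i)) * (occurrence_poly X k w - occurrence_poly X k w'))"
    by (simp add: F_def algebra_simps sum_subtractf)
  then have 2: "F w - F w' \<in> I" by (auto intro!: sum_I mult_I law)
  have "of_int (int (?N w) - int (?N w')) = (F w - F w') - ((F w - of_nat (?N w)) - (F w' - of_nat (?N w')))"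
    by simp
  also have "\<dots> \<in> I" by (intro diff_I 1 2)
  finally have "int p dvd int (?N w) - int (?N w')" by (rule of_int_I_imp_dvd)
  also have "int (?N w) - int (?N w') = int q ^ card D * (int (occurrences q a w) - int (occurrences q a w'))"
    by (simp add: algebra_simps)
  \<comment> \<open>The factor \<open>q ^ card D\<close> is prime to \<open>p\<close> and
    cancels.\<close>
  finally have "int p dvd int (occurrences q a w) - int (occurrences q a w')"
    using q_not_dvd prime_p by (simp add: prime_dvd_mult_iff)
  then show ?thesis by (metis mod_eq_dvd_iff of_nat_eq_iff of_nat_mod)
qed

end

subsection \<open>Laws of groups with a nontrivial coprime action\<close>

locale group_endo = comm_group A for A (structure) +
  fixes \<sigma>
  assumes endo: "\<sigma> \<in> hom A A"
begin

sublocale group_hom A A \<sigma>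
  by unfold_locales (rule endo)

text \<open>Horner's scheme: the abelian group becomes a module over the integer polynomials in
  which the variable acts as \<open>\<sigma>\<close>; in multiplicative notation scalars are
  exponents.\<close>

definition poly_act :: "int poly \<Rightarrow> 'a \<Rightarrow> 'a" where
  "poly_act f v = fold_coeffs (\<lambda>a r. v [^] a \<otimes> \<sigma> r) f \<one>"

lemma poly_act_0 [simp]: "poly_act 0 v = \<one>"
  by (simp add: poly_act_def)

lemma poly_act_pCons [simp]:
  "poly_act (pCons a f) v = v [^] a \<otimes> \<sigma> (poly_act f v)"
proof (cases "a = 0 \<and> f = 0")
  case True
  then show ?thesis by simp
next
  case False
  then show ?thesis
    by (auto simp: poly_act_def)
qed

lemma poly_act_closed [simp]: "v \<in> carrier A \<Longrightarrow> poly_act f v \<in> carrier A"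
  by (induction f) auto

lemma poly_act_one_right [simp]: "poly_act f \<one> = \<one>"
  by (induction f) (auto simp: int_pow_one)

lemma poly_act_one [simp]: "v \<in> carrier A \<Longrightarrow> poly_act 1 v = v"
  by (simp add: one_pCons)

lemma poly_act_add:
  "v \<in> carrier A \<Longrightarrow> poly_act (f + g) v = poly_act f v \<otimes> poly_act g v"
  by (induction f g rule: poly_induct2) (auto simp: int_pow_mult m_ac)

lemma poly_act_smult:
  "v \<in> carrier A \<Longrightarrow> poly_act (Polynomial.smult a f) v = poly_act f v [^] a"
  by (induction f) (auto simp: int_pow_one int_pow_distrib hom_int_pow int_pow_pow mult.commute)

lemma poly_act_mult:
  "v \<in> carrier A \<Longrightarrow> poly_act (f * g) v = poly_act f (poly_act g v)"
  by (induction f) (auto simp: poly_act_add poly_act_smult)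

lemma poly_act_minus:
  "v \<in> carrier A \<Longrightarrow> poly_act (- f) v = inv (poly_act f v)"
  using poly_act_smult[of v "-1" f] by (simp add: int_pow_neg)

lemma poly_act_diff:
  "v \<in> carrier A \<Longrightarrow> poly_act (f - g) v = poly_act f v \<otimes> inv (poly_act g v)"
  using poly_act_add[of v f "- g"] by (simp add: poly_act_minus)

lemma poly_act_of_nat:
  "v \<in> carrier A \<Longrightarrow> poly_act (of_nat m) v = v [^] m"
  by (simp add: of_nat_poly int_pow_int)

lemma endo_funpow_closed [simp]: "v \<in> carrier A \<Longrightarrow> (\<sigma> ^^ k) v \<in> carrier A"
  by (induction k) auto

lemma poly_act_X_power:
  "v \<in> carrier A \<Longrightarrow> poly_act ([:0, 1:] ^ k) v = (\<sigma> ^^ k) v"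
  by (induction k) (auto simp: poly_act_mult)

text \<open>The value of the norm element at \<open>\<sigma> v - v\<close> telescopes to \<open>\<sigma>\<^sup>q v - v\<close>.\<close>

lemma cyclotomic_idealI:
  assumes "prime p" "prime q" "p \<noteq> q" "v \<in> carrier A" "v [^] p = \<one>"
    and "\<sigma> v \<noteq> v" "(\<sigma> ^^ q) v = v"
  shows "cyclotomic_ideal {f. poly_act f (poly_act ([:0, 1:] - 1) v) = \<one>} p q [:0, 1:]"
proof
  let ?X = "[:0, 1:] :: int poly"
  let ?u = "poly_act (?X - 1) v"
  have u: "?u \<in> carrier A" "?u = \<sigma> v \<otimes> inv v"
    using assms(4) poly_act_X_power[of v 1] by (simp_all add: poly_act_diff)
  show "of_nat p \<in> {f. poly_act f ?u = \<one>}"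
  proof -
    \<comment> \<open>Polynomials commute, so \<open>p\<close> may act on \<open>v\<close> first,
      and it annihilates \<open>v\<close>.\<close>
    have "poly_act (of_nat p) ?u = poly_act (of_nat p * (?X - 1)) v"
      using assms(4) by (simp add: poly_act_mult)
    also have "\<dots> = poly_act ((?X - 1) * of_nat p) v" by (simp only: mult.commute)
    also have "\<dots> = \<one>"
      using assms(4,5) by (simp only: poly_act_mult poly_act_of_nat poly_act_one_right)
    finally show ?thesis by simp
  qed
  show "(\<Sum>i<q. ?X ^ i) \<in> {f. poly_act f ?u = \<one>}"
  proof -
    have "poly_act (\<Sum>i<q. ?X ^ i) ?u = poly_act ((\<Sum>i<q. ?X ^ i) * (?X - 1)) v"
      using assms(4) by (simp only: poly_act_mult)
    also have "(\<Sum>i<q. ?X ^ i) * (?X - 1) = ?X ^ q - 1"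
      by (simp only: power_diff_1_eq mult.commute)
    also have "poly_act \<dots> v = \<one>"
      using assms(4,7) by (simp only: poly_act_diff poly_act_X_power poly_act_one r_inv)
    finally show ?thesis by simp
  qed
  show "1 \<notin> {f. poly_act f ?u = \<one>}"
  proof
    assume "1 \<in> {f. poly_act f ?u = \<one>}"
    then have "\<sigma> v \<otimes> inv v = \<one>" using u by simp
    moreover have "\<sigma> v = \<sigma> v \<otimes> inv v \<otimes> v"
      using assms(4) by (simp add: m_assoc)
    ultimately have "\<sigma> v = v" using assms(4) by simp
    with assms(6) show False by simp
  qed
qed (use assms in \<open>simp_all add: poly_act_add poly_act_mult\<close>)

end

text \<open>Substitute an element \<open>?u\<close> of \<open>V\<close> for letter \<open>0\<close>
  and \<open>g [^] k i\<close> for letter \<open>i\<close>. Collecting the powers of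
  \<open>g\<close> in front leaves the occurrence polynomial acting on \<open>?u\<close>. Once the
  powers of \<open>g\<close> cancel, a law makes the two polynomials congruent modulo the
  annihilator of \<open>?u\<close> for every \<open>k\<close>, and Fourier inversion recovers the
  counts.\<close>

lemma (in group) wreath_law_if_group_law:
  assumes V: "subgroup V G" "\<And>x y. x \<in> V \<Longrightarrow> y \<in> V \<Longrightarrow> x \<otimes> y = y \<otimes> x"
      "\<And>x. x \<in> V \<Longrightarrow> x [^] p = \<one>"
    and g: "g \<in> carrier G" "\<And>x. x \<in> V \<Longrightarrow> inv g \<otimes> x \<otimes> g \<in> V"
    and v: "v \<in> V" "g \<otimes> v \<noteq> v \<otimes> g" "g [^] q \<otimes> v = v \<otimes> g [^] q"
    and pq: "prime p" "prime q" "p \<noteq> q"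
    and law: "group_law G w w'"
  shows "wreath_law p q w w'"
proof -
  define A where "A = G\<lparr>carrier := V\<rparr>"
  define \<sigma> where "\<sigma> = (\<lambda>x. inv g \<otimes> x \<otimes> g)"
  let ?X = "[:0, 1:] :: int poly"
  have VG: "x \<in> carrier G" if "x \<in> V" for x using that V(1) subgroup.subset by blast
  have cA: "comm_group A"
    unfolding A_def using V(1,2)
    by (intro group.group_comm_groupI subgroup_imp_group) auto
  have A: "carrier A = V" "x \<otimes>\<^bsub>A\<^esub> y = x \<otimes> y" "\<one>\<^bsub>A\<^esub> = \<one>" for x y by (simp_all add: A_def)
  have mult_assoc4: "inv g \<otimes> (x \<otimes> y) \<otimes> g = (inv g \<otimes> x \<otimes> g) \<otimes> (inv g \<otimes> y \<otimes> g)"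
    if "x \<in> carrier G" "y \<in> carrier G" for x y
  proof -
    have "g \<otimes> (inv g \<otimes> z) = z" if "z \<in> carrier G" for z
      using that g(1) by (simp add: m_assoc[symmetric])
    then show ?thesis using that g(1) by (simp add: m_assoc)
  qed
  have "\<sigma> \<in> hom A A"
    using g mult_assoc4 VG by (auto simp: hom_def A \<sigma>_def)
  then interpret A: group_endo A \<sigma>
    using cA by (simp add: group_endo_def group_endo_axioms_def)
  have \<sigma>_pow: "(\<sigma> ^^ k) x = inv (g [^] k) \<otimes> x \<otimes> g [^] k" if "x \<in> carrier G" for k x
  proof (induction k)
    case (Suc k)
    have "(\<sigma> ^^ Suc k) x = inv g \<otimes> (inv (g [^] k) \<otimes> x \<otimes> g [^] k) \<otimes> g"
      using Suc by (simp add: \<sigma>_def)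
    also have "\<dots> = (inv g \<otimes> inv (g [^] k)) \<otimes> x \<otimes> (g [^] k \<otimes> g)"
      using that g(1) by (simp add: m_assoc)
    also have "inv g \<otimes> inv (g [^] k) = inv (g [^] Suc k)"
      using g(1) by (simp add: inv_mult_group)
    finally show ?case by simp
  qed (use that in simp)
  have move: "x \<otimes> g [^] k = g [^] k \<otimes> (\<sigma> ^^ k) x" if "x \<in> carrier G" for k :: nat and x
    using that g(1) by (simp add: \<sigma>_pow m_assoc[symmetric])
  \<comment> \<open>In place of \<open>v\<close> itself, its image under \<open>X - 1\<close> is
    used: the norm element then acts as \<open>X ^ q - 1\<close> on \<open>v\<close>, hence
    trivially.\<close>
  let ?u = "A.poly_act (?X - 1) v"
  let ?I = "{f. A.poly_act f ?u = \<one>\<^bsub>A\<^esub>}"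
  have vG: "v \<in> carrier G" using VG v(1) .
  interpret cyclotomic_ideal ?I p q ?X
  proof (rule A.cyclotomic_idealI[OF pq])
    show "v \<in> carrier A" using v(1) by (simp add: A)
    show "v [^]\<^bsub>A\<^esub> p = \<one>\<^bsub>A\<^esub>"
      using V(3)[OF v(1)] by (simp add: A_def nat_pow_consistent[symmetric])
    show "\<sigma> v \<noteq> v"
      using v(2) move[OF vG, of 1] g(1) by (intro notI) simp
    show "(\<sigma> ^^ q) v = v"
    proof -
      have "(\<sigma> ^^ q) v = inv (g [^] q) \<otimes> (v \<otimes> g [^] q)"
        using g(1) vG by (simp add: \<sigma>_pow m_assoc)
      also have "\<dots> = inv (g [^] q) \<otimes> g [^] q \<otimes> v"
        using g(1) vG by (simp only: v(3)[symmetric] m_assoc inv_closed nat_pow_closed)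
      finally show ?thesis using g(1) vG by simp
    qed
  qed
  have uA: "?u \<in> carrier A" using v(1) by (intro A.poly_act_closed) (simp add: A(1))
  have closed: "A.poly_act f ?u \<in> V" for f using A.poly_act_closed[OF uA] by (simp add: A(1))
  have u: "?u \<in> V" using uA by (simp add: A(1))
  have eq_I: "f - f' \<in> ?I" if "A.poly_act f ?u = A.poly_act f' ?u" for f f'
    using that uA by (simp add: A.poly_act_diff)
  define \<gamma> where "\<gamma> = (\<lambda>(k :: nat \<Rightarrow> nat) i. if i = 0 then ?u else g [^] k i)"
  have ev: "word_eval G (\<gamma> k) w = g [^] weight k w \<otimes> A.poly_act (occurrence_poly ?X k w) ?u"
    for k w
  proof (induction w)
    case Nil
    show ?case by (simp add: A)
  next
    case (Cons l w)
    let ?g = "g [^] weight k w" and ?r = "A.poly_act (occurrence_poly ?X k w) ?u"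
    have r: "?r \<in> carrier G" "?g \<in> carrier G" "?u \<in> carrier G"
      using VG closed g(1) u by auto
    show ?case
    proof (cases "l = 0")
      case True
      have "(\<sigma> ^^ weight k w) ?u \<in> V"
        using closed[of "?X ^ weight k w"] by (simp add: A.poly_act_X_power[OF uA])
      then have s: "(\<sigma> ^^ weight k w) ?u \<in> carrier G" "(\<sigma> ^^ weight k w) ?u \<otimes> ?r = ?r \<otimes> (\<sigma> ^^ weight k w) ?u"
        using VG V(2) closed by auto
      have "word_eval G (\<gamma> k) (l # w) = (?u \<otimes> ?g) \<otimes> ?r"
        using True Cons r by (simp add: \<gamma>_def m_assoc)
      also have "\<dots> = ?g \<otimes> (?r \<otimes> (\<sigma> ^^ weight k w) ?u)"
        using r s by (simp add: move m_assoc)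
      also have "?r \<otimes> (\<sigma> ^^ weight k w) ?u = A.poly_act (occurrence_poly ?X k (l # w)) ?u"
        using True by (simp add: A.poly_act_add[OF uA] A.poly_act_X_power[OF uA] A(2))
      finally show ?thesis using True by simp
    next
      case False
      then show ?thesis using Cons r g(1) by (simp add: \<gamma>_def nat_pow_mult m_assoc[symmetric])
    qed
  qed
  \<comment> \<open>Sending letter \<open>0\<close> to \<open>\<one>\<close> isolates the power of
    \<open>g\<close>, which can then be cancelled.\<close>
  have ev1: "word_eval G (\<lambda>i. if i = 0 then \<one> else g [^] k i) w = g [^] weight k w" for k :: "nat \<Rightarrow> nat" and w
    by (induction w) (use g(1) in \<open>auto simp: nat_pow_mult\<close>)
  have "occurrence_poly ?X k w - occurrence_poly ?X k w' \<in> ?I" for k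
  proof (rule eq_I)
    have "range (\<gamma> k) \<subseteq> carrier G" using u VG g(1) by (auto simp: \<gamma>_def)
    then have 1: "word_eval G (\<gamma> k) w = word_eval G (\<gamma> k) w'"
      using law by (simp add: group_law_def)
    have "range (\<lambda>i. if i = 0 then \<one> else g [^] k i) \<subseteq> carrier G"
      using g(1) by auto
    then have 2: "g [^] weight k w = g [^] weight k w'"
      using law unfolding group_law_def ev1[symmetric] by blast
    from 1 show "A.poly_act (occurrence_poly ?X k w) ?u = A.poly_act (occurrence_poly ?X k w') ?u"
      using g(1) VG[OF closed] unfolding ev 2 by simp
  qed
  \<comment> \<open>Sending only letter \<open>i\<close> to \<open>g\<close> yields powers of
    \<open>g\<close>; conjugating \<open>?u\<close> by them turns their equality into one between
    powers of \<open>X\<close> modulo the ideal.\<close>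
  moreover have "count_list w i mod q = count_list w' i mod q" for i
  proof (rule X_power_diff_imp_mod_eq, rule eq_I)
    have comm: "g \<otimes> g [^] m = g [^] m \<otimes> g" for m :: nat
      using nat_pow_Suc2[OF g(1), of m] by simp
    have c: "word_eval G (\<lambda>j. if j = i then g else \<one>) w = g [^] count_list w i" for w
      by (induction w) (use g(1) in \<open>auto simp: comm\<close>)
    have "range (\<lambda>j. if j = i then g else \<one>) \<subseteq> carrier G" using g(1) by auto
    then have "g [^] count_list w i = g [^] count_list w' i"
      using law unfolding group_law_def c[symmetric] by blast
    then show "A.poly_act (?X ^ count_list w i) ?u = A.poly_act (?X ^ count_list w' i) ?u"
      using VG[OF u] by (simp add: A.poly_act_X_power[OF uA] \<sigma>_pow)
  qed
  ultimately show ?thesis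
    unfolding wreath_law_def by (intro conjI allI impI occurrences_mod_eq) simp_all
qed

section \<open>Reduction to minimal nonnilpotent groups\<close>

lemma (in group) group_law_subgroup:
  assumes "subgroup H G" "group_law G w w'"
  shows "group_law (G\<lparr>carrier := H\<rparr>) w w'"
proof -
  have "word_eval (G\<lparr>carrier := H\<rparr>) \<gamma> w = word_eval G \<gamma> w" for \<gamma> w by (induction w) auto
  moreover have "range \<gamma> \<subseteq> H \<Longrightarrow> range \<gamma> \<subseteq> carrier G" for \<gamma> :: "nat \<Rightarrow> 'a"
    using subgroup.subset[OF assms(1)] by blast
  ultimately show ?thesis using assms(2) by (simp add: group_law_def)
qed

lemma (in group_hom) group_law_surj_hom:
  assumes "h ` carrier G = carrier H" "group_law G w w'"
  shows "group_law H w w'"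
  unfolding group_law_def
proof (intro allI impI)
  fix \<gamma> :: "nat \<Rightarrow> 'c" assume \<gamma>: "range \<gamma> \<subseteq> carrier H"
  define \<delta> where "\<delta> i = inv_into (carrier G) h (\<gamma> i)" for i
  have mem: "\<gamma> i \<in> h ` carrier G" for i using \<gamma> assms(1) by blast
  have \<delta>: "range \<delta> \<subseteq> carrier G" "h (\<delta> i) = \<gamma> i" for i
    using inv_into_into[OF mem] f_inv_into_f[OF mem] by (auto simp: \<delta>_def)
  have "word_eval H \<gamma> w = h (word_eval G \<delta> w)" for w
  proof (induction w)
    case (Cons i w)
    have "\<delta> i \<in> carrier G" using \<delta>(1) by blast
    then show ?case using Cons \<delta> by simp
  qed simp
  moreover have "word_eval G \<delta> w = word_eval G \<delta> w'"
    using assms(2) \<delta>(1) by (simp add: group_law_def)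
  ultimately show "word_eval H \<gamma> w = word_eval H \<gamma> w'" by simp
qed

text \<open>Restricting the carrier type to \<^typ>\<open>nat\<close> lets the induction pass to quotients.\<close>

lemma nonnilpotent_imp_wreath_law_nat:
  fixes K :: "nat monoid"
  assumes "group K" "finite (carrier K)" "\<not> nilpotent_group K"
  shows "\<exists>p q. prime p \<and> prime q \<and> (\<forall>w w'. group_law K w w' \<longrightarrow> wreath_law p q w w')"
  using assms
proof (induction "order K" arbitrary: K rule: less_induct)
  case less
  interpret group K by fact
  have fin: "finite (carrier K)" by fact
  have nontrivial: "carrier K \<noteq> {\<one>\<^bsub>K\<^esub>}"
    using nilpotent_trivial less.prems(3) by auto
  show ?case
  proof (cases "\<forall>H. subgroup H K \<longrightarrow> H \<noteq> carrier K \<longrightarrow> nilpotent_group (K\<lparr>carrier := H\<rparr>)")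
    case False
    then obtain H where H: "subgroup H K" "H \<noteq> carrier K" "\<not> nilpotent_group (K\<lparr>carrier := H\<rparr>)"
      by blast
    have HK: "H \<subset> carrier K" using subgroup.subset[OF H(1)] H(2) by blast
    then have "order (K\<lparr>carrier := H\<rparr>) < order K"
      using psubset_card_mono[OF fin] by (simp add: order_def)
    moreover have "finite (carrier (K\<lparr>carrier := H\<rparr>))"
      using HK fin finite_subset by auto
    ultimately obtain p q where "prime p" "prime q"
      "\<forall>w w'. group_law (K\<lparr>carrier := H\<rparr>) w w' \<longrightarrow> wreath_law p q w w'"
      using less.hyps[OF _ subgroup_imp_group[OF H(1)] _ H(3)] by auto
    then show ?thesis using group_law_subgroup[OF H(1)] by (intro exI[of _ p] exI[of _ q]) simp
  next
    case proper: True
    define Z where "Z = {x \<in> carrier K. \<forall>v \<in> carrier K. x \<otimes>\<^bsub>K\<^esub> v = v \<otimes>\<^bsub>K\<^esub> x}"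
    have Z: "subgroup Z K" unfolding Z_def by (rule subgroup_centralizer) simp
    have Zcomm: "x \<otimes>\<^bsub>K\<^esub> y = y \<otimes>\<^bsub>K\<^esub> x" if "x \<in> Z" "y \<in> carrier K" for x y
      using that unfolding Z_def by blast
    show ?thesis
    proof (cases "Z = {\<one>\<^bsub>K\<^esub>}")
      case False
      have "x \<otimes>\<^bsub>K\<^esub> z \<otimes>\<^bsub>K\<^esub> inv\<^bsub>K\<^esub> x = z" if "x \<in> carrier K" "z \<in> Z" for x z
      proof -
        have "z \<in> carrier K" by (rule subgroup.mem_carrier[OF Z that(2)])
        then have "z \<otimes>\<^bsub>K\<^esub> x \<otimes>\<^bsub>K\<^esub> inv\<^bsub>K\<^esub> x = z"
          using that(1) by (simp add: m_assoc)
        then show ?thesis unfolding Zcomm[OF that(2,1)] .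
      qed
      then have "Z \<lhd> K" using Z by (simp add: normal_inv_iff)
      \<comment> \<open>The quotient by the center is smaller, still not nilpotent, and inherits the
        laws of \<open>K\<close>, so the induction hypothesis applies to it.\<close>
      then obtain K' :: "nat monoid" and \<phi> where K': "group_hom K K' \<phi>"
        "\<phi> ` carrier K = carrier K'" "\<forall>x \<in> carrier K. \<phi> x = \<one>\<^bsub>K'\<^esub> \<longrightarrow> x \<in> Z"
        "order K' * card Z = order K"
        using nat_quotient[OF fin] by blast
      interpret \<phi>: group_hom K K' \<phi> by (rule K'(1))
      have "\<not> nilpotent_group K'"
      proof
        assume "nilpotent_group K'"
        then have "nilpotent_group K"
          by (rule \<phi>.nilpotent_if_central_kernel) (rule Zcomm, use K'(3) in simp_all)
        with less.prems(3) show False by contradiction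
      qed
      moreover have fin': "finite (carrier K')" unfolding K'(2)[symmetric] using fin by (rule finite_imageI)
      moreover have "order K' < order K"
      proof -
        have "{\<one>\<^bsub>K\<^esub>} \<subset> Z" using subgroup.one_closed[OF Z] False by blast
        moreover have "finite Z" using subgroup.subset[OF Z] fin by (rule finite_subset)
        ultimately have "1 < card Z"
          using psubset_card_mono[of Z "{\<one>\<^bsub>K\<^esub>}"] by simp
        moreover have "order K' > 0" using fin' \<phi>.H.order_gt_0_iff_finite by simp
        ultimately have "order K' * 1 < order K' * card Z" by (intro mult_strict_left_mono)
        then show ?thesis using K'(4) by simp
      qed
      ultimately obtain p q where "prime p" "prime q"
        "\<forall>w w'. group_law K' w w' \<longrightarrow> wreath_law p q w w'"
        using less.hyps[OF _ \<phi>.H.is_group] by auto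
      then show ?thesis using \<phi>.group_law_surj_hom[OF K'(2)] by (intro exI[of _ p] exI[of _ q]) simp
    next
      case True
      interpret minimal_nonnilpotent K
      proof
        show "z = \<one>\<^bsub>K\<^esub>" if "z \<in> carrier K" "\<forall>y \<in> carrier K. z \<otimes>\<^bsub>K\<^esub> y = y \<otimes>\<^bsub>K\<^esub> z" for z
        proof -
          have "z \<in> Z" unfolding Z_def using that by (intro CollectI conjI)
          with True show ?thesis by simp
        qed
      qed (use proper fin nontrivial in auto)
      from ex_elementary_abelian_section obtain p q :: nat and V g v
        where pq: "prime p" "prime q" "p \<noteq> q" and V: "subgroup V K"
          "\<forall>x \<in> V. \<forall>y \<in> V. x \<otimes>\<^bsub>K\<^esub> y = y \<otimes>\<^bsub>K\<^esub> x" "\<forall>x \<in> V. x [^]\<^bsub>K\<^esub> p = \<one>\<^bsub>K\<^esub>"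
        and g: "g \<in> carrier K" "\<forall>x \<in> V. inv\<^bsub>K\<^esub> g \<otimes>\<^bsub>K\<^esub> x \<otimes>\<^bsub>K\<^esub> g \<in> V"
        and v: "v \<in> V" "g \<otimes>\<^bsub>K\<^esub> v \<noteq> v \<otimes>\<^bsub>K\<^esub> g" "g [^]\<^bsub>K\<^esub> q \<otimes>\<^bsub>K\<^esub> v = v \<otimes>\<^bsub>K\<^esub> g [^]\<^bsub>K\<^esub> q"
        by (elim exE conjE) (rule that; assumption)
      have "wreath_law p q w w'" if "group_law K w w'" for w w'
        by (rule wreath_law_if_group_law[OF V(1) V(2)[rule_format] V(3)[rule_format]
              g(1) g(2)[rule_format] v pq that])
      then show ?thesis using pq(1,2) by (intro exI[of _ p] exI[of _ q]) simp
    qed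
  qed
qed

theorem theorem1p1:
  fixes G :: "('g, 'm) monoid_scheme"
    and S :: "'s set"
    and \<alpha> :: "'g \<Rightarrow> 's \<Rightarrow> 's"
  assumes "group G"
    and "finite (carrier G)"
    and "\<not> nilpotent_group G"
    and "finite S"
    and "faithful_action G S \<alpha>"
  shows "inherently_nonfinitely_based_fin fd_arity (action_algebra G S \<alpha>)"
proof -
  interpret group G by fact
  obtain K :: "nat monoid" and \<phi> where K: "group K" "\<phi> \<in> hom G K" "\<phi> ` carrier G = carrier K"
    "inj_on \<phi> (carrier G)"
    using nat_copy[OF assms(2)] by blast
  interpret \<phi>: group_hom G K \<phi>
    using K assms(1) by (simp add: group_hom_def group_hom_axioms_def)
  have "\<not> nilpotent_group K"
  proof
    assume "nilpotent_group K"
    \<comment> \<open>The copy has trivial kernel, which is central in particular.\<close>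
    then have "nilpotent_group G"
    proof (rule \<phi>.nilpotent_if_central_kernel)
      fix x y assume xy: "x \<in> carrier G" "y \<in> carrier G" "\<phi> x = \<one>\<^bsub>K\<^esub>"
      then have "x = \<one>\<^bsub>G\<^esub>"
        using inj_onD[OF K(4), of x "\<one>\<^bsub>G\<^esub>"] by simp
      then show "x \<otimes>\<^bsub>G\<^esub> y = y \<otimes>\<^bsub>G\<^esub> x" using xy by simp
    qed
    with assms(3) show False by contradiction
  qed
  moreover have "finite (carrier K)" unfolding K(3)[symmetric] using assms(2) by (rule finite_imageI)
  ultimately obtain p q where pq: "prime p" "prime q"
    "\<forall>w w'. group_law K w w' \<longrightarrow> wreath_law p q w w'"
    using nonnilpotent_imp_wreath_law_nat[OF K(1)] by blast
  have "carrier G \<noteq> {\<one>\<^bsub>G\<^esub>}" using nilpotent_trivial assms(3) by auto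
  then show ?thesis
    using pq \<phi>.group_law_surj_hom[OF K(3)] prime_ge_2_nat
    by (intro inherently_nonfinitely_based_finI[OF assms(5), of p q]) simp_all
qed

end
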